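(* Let $(M=\mathbb{R}\times M_0,\langle\cdot,\cdot\rangle)$ be a standard stationary spacetime, with $\langle\cdot,\cdot\rangle=-\beta(x)\,dt^2+\langle\cdot,\cdot\rangle_R+2\langle\delta,\cdot\rangle_R\,dt$. Let $\phi:\mathbb{R}\times M_0\to\mathbb{R}$ be a smooth function independent of $t$, let $p=(t,x)\in M$, and let $\tilde v=t_0'\partial_t+v$ be a vector in $T_pM=T_t\mathbb{R}\times T_xM_0$ (with $t_0'\in\mathbb{R}$, $v\in T_xM_0$). Then $$\mathrm{Hess}_\phi(p)[\tilde v,\tilde v]=\mathrm{Hess}^R_\phi(x)[v,v]-\Lambda\Big(t_0'\,v(\beta)+\tfrac12 t_0'^2\,\delta(\beta)-\mathrm{Sym}\nabla^R\delta(v,v)+t_0'\,\mathrm{rot}\,\delta(v,\delta)\Big)\delta(\phi)+t_0'\,\mathrm{rot}\,\delta(\nabla^R\phi,v)-\tfrac12 t_0'^2\,\nabla^R\beta(\phi),$$ where $\Lambda=-1/(\beta+\|\delta\|_R^2)$.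
   Context: A (standard) stationary spacetime is the product manifold $M=\mathbb{R}\times M_0$, where $(M_0,\langle\cdot,\cdot\rangle_R)$ is a Riemannian manifold, endowed with the Lorentz metric $\langle\cdot,\cdot\rangle=-\beta(x)\,dt^2+\langle\cdot,\cdot\rangle_R+2\langle\delta,\cdot\rangle_R\,dt$, where $\delta$ is a smooth vector field on $M_0$ and $\beta$ is a positive smooth function on $M_0$; that is, $\langle(\tau,v),(\tau,v)\rangle=-\beta(x)\tau^2+\langle v,v\rangle_R+2\tau\langle\delta(x),v\rangle_R$ for $\tau\in\mathbb{R}$, $v\in T_xM_0$. $\nabla$ and $\nabla^R$ denote the Levi-Civita connections of $\langle\cdot,\cdot\rangle$ and $\langle\cdot,\cdot\rangle_R$. The Hessian is $\mathrm{Hess}_\phi[\tilde V,\tilde V]=\tilde V\tilde V\phi-(\nabla_{\tilde V}\tilde V)\phi$, and $\mathrm{Hess}^R_\phi$ is the Hessian, with respect to $\langle\cdot,\cdot\rangle_R$, of $\phi$ viewed as a function on $M_0$. $\nabla^R\phi,\nabla^R\beta$ are the $\langle\cdot,\cdot\rangle_R$-gradients on $M_0$; $X(f)$ denotes the derivative of a function $f$ in the direction of $X$ (so $\nabla^R\beta(\phi)=\langle\nabla^R\beta,\nabla^R\phi\rangle_R$); $\|\cdot\|_R$ is the $\langle\cdot,\cdot\rangle_R$-norm. One writes $\nabla^R\delta(V,W)=\langle\nabla^R_V\delta,W\rangle_R$, $\mathrm{Sym}\nabla^R\delta(V,W)=\frac12(\nabla^R\delta(V,W)+\nabla^R\delta(W,V))$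 and $\mathrm{rot}\,\delta(V,W)=\nabla^R\delta(V,W)-\nabla^R\delta(W,V)$. All quantities on $M_0$ are evaluated at $x$. *)

theory Defs
  imports "HOL-Analysis.Analysis"
begin

text \<open>For open \<open>S\<close>, \<open>Ck_on k S f\<close> says that \<open>f\<close> is of class \<open>C\<^sup>k\<close> on \<open>S\<close>:
  all iterated directional derivatives up to order \<open>k\<close> exist and are continuous.\<close>

primrec Ck_on :: "nat \<Rightarrow> 'a::euclidean_space set \<Rightarrow> ('a \<Rightarrow> 'b::real_normed_vector) \<Rightarrow> bool" where
  "Ck_on 0 S f \<longleftrightarrow> continuous_on S f"
| "Ck_on (Suc k) S f \<longleftrightarrow>
     (\<forall>x\<in>S. f differentiable (at x)) \<and> (\<forall>v. Ck_on k S (\<lambda>x. frechet_derivative f (at x) v))"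

definition smooth_on :: "'a::euclidean_space set \<Rightarrow> ('a \<Rightarrow> 'b::real_normed_vector) \<Rightarrow> bool" where
  "smooth_on S f \<longleftrightarrow> (\<forall>k. Ck_on k S f)"

text \<open>A chart is a pair of its domain and its coordinate map; the values of the coordinate map
  outside the domain are irrelevant.\<close>

type_synonym ('m, 'e) chart = "'m set \<times> ('m \<Rightarrow> 'e)"

definition is_chart :: "('m::topological_space, 'e::euclidean_space) chart \<Rightarrow> bool" where
  "is_chart = (\<lambda>(U, c). open U \<and> open (c ` U) \<and> homeomorphism U (c ` U) c (inv_into U c))"

definition compatible :: "('m, 'e::euclidean_space) chart \<Rightarrow> ('m, 'e) chart \<Rightarrow> bool" where
  "compatible = (\<lambda>(U, c) (V, d). smooth_on (c ` (U \<inter> V)) (d \<circ> inv_into U c))"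

text \<open>A smooth manifold is a Hausdorff, second countable type together with an atlas, which need
  not be maximal; the model space \<open>'e\<close> determines the dimension.\<close>

definition smooth_atlas ::
  "('m::{t2_space, second_countable_topology}, 'e::euclidean_space) chart set \<Rightarrow> bool" where
  "smooth_atlas A \<longleftrightarrow>
     (\<forall>C\<in>A. is_chart C) \<and> (\<forall>C\<in>A. \<forall>D\<in>A. compatible C D) \<and> (\<Union>(fst ` A)) = UNIV"

definition smooth_fun :: "('m, 'e::euclidean_space) chart set \<Rightarrow> ('m \<Rightarrow> real) \<Rightarrow> bool" where
  "smooth_fun A f \<longleftrightarrow> (\<forall>(U, c)\<in>A. smooth_on (c ` U) (f \<circ> inv_into U c))"

text \<open>Tangent vectors at \<open>p\<close> are the derivations at \<open>p\<close> of the algebra of smooth functions. They are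
  set to \<open>0\<close> on all other functions, so that equality of tangent vectors is equality in HOL.\<close>

type_synonym 'm tvec = "('m \<Rightarrow> real) \<Rightarrow> real"
type_synonym 'm vfield = "'m \<Rightarrow> 'm tvec"

definition tangent_space :: "('m, 'e::euclidean_space) chart set \<Rightarrow> 'm \<Rightarrow> 'm tvec set" where
  "tangent_space A p = {v.
     (\<forall>f g a b. smooth_fun A f \<longrightarrow> smooth_fun A g \<longrightarrow>
        v (\<lambda>q. a * f q + b * g q) = a * v f + b * v g) \<and>
     (\<forall>f g. smooth_fun A f \<longrightarrow> smooth_fun A g \<longrightarrow>
        v (\<lambda>q. f q * g q) = f p * v g + g p * v f) \<and>
     (\<forall>f. \<not> smooth_fun A f \<longrightarrow> v f = 0)}"

definition lincomb :: "real \<Rightarrow> 'm tvec \<Rightarrow> real \<Rightarrow> 'm tvec \<Rightarrow> 'm tvec" where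
  "lincomb a v b w = (\<lambda>f. a * v f + b * w f)"

definition vf_apply :: "'m vfield \<Rightarrow> ('m \<Rightarrow> real) \<Rightarrow> 'm \<Rightarrow> real" where
  "vf_apply X f = (\<lambda>p. X p f)"

definition smooth_vfield :: "('m, 'e::euclidean_space) chart set \<Rightarrow> 'm vfield \<Rightarrow> bool" where
  "smooth_vfield A X \<longleftrightarrow>
     (\<forall>p. X p \<in> tangent_space A p) \<and> (\<forall>f. smooth_fun A f \<longrightarrow> smooth_fun A (vf_apply X f))"

type_synonym 'm metric_field = "'m \<Rightarrow> 'm tvec \<Rightarrow> 'm tvec \<Rightarrow> real"

definition riemannian_metric ::
  "('m, 'e::euclidean_space) chart set \<Rightarrow> 'm metric_field \<Rightarrow> bool" where
  "riemannian_metric A g \<longleftrightarrow>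
     (\<forall>p. \<forall>u\<in>tangent_space A p. \<forall>v\<in>tangent_space A p. g p u v = g p v u) \<and>
     (\<forall>p. \<forall>u\<in>tangent_space A p. \<forall>v\<in>tangent_space A p. \<forall>w\<in>tangent_space A p. \<forall>a b.
        g p (lincomb a u b v) w = a * g p u w + b * g p v w) \<and>
     (\<forall>p. \<forall>v\<in>tangent_space A p. v \<noteq> (\<lambda>f. 0) \<longrightarrow> 0 < g p v v) \<and>
     (\<forall>X Y. smooth_vfield A X \<longrightarrow> smooth_vfield A Y \<longrightarrow> smooth_fun A (\<lambda>p. g p (X p) (Y p)))"

text \<open>\<open>D p v Y\<close> is the covariant derivative at \<open>p\<close> of the vector field \<open>Y\<close> in the direction of the
  tangent vector \<open>v\<close> at \<open>p\<close>.\<close>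

type_synonym 'm connection = "'m \<Rightarrow> 'm tvec \<Rightarrow> 'm vfield \<Rightarrow> 'm tvec"

definition affine_connection ::
  "('m, 'e::euclidean_space) chart set \<Rightarrow> 'm connection \<Rightarrow> bool" where
  "affine_connection A D \<longleftrightarrow>
     (\<forall>X Y. smooth_vfield A X \<longrightarrow> smooth_vfield A Y \<longrightarrow> smooth_vfield A (\<lambda>p. D p (X p) Y)) \<and>
     (\<forall>p Y. smooth_vfield A Y \<longrightarrow> (\<forall>v\<in>tangent_space A p. D p v Y \<in> tangent_space A p)) \<and>
     (\<forall>p Y a b. smooth_vfield A Y \<longrightarrow> (\<forall>u\<in>tangent_space A p. \<forall>v\<in>tangent_space A p.
        D p (lincomb a u b v) Y = lincomb a (D p u Y) b (D p v Y))) \<and>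
     (\<forall>p Y Z. smooth_vfield A Y \<longrightarrow> smooth_vfield A Z \<longrightarrow> (\<forall>v\<in>tangent_space A p.
        D p v (\<lambda>q. lincomb 1 (Y q) 1 (Z q)) = lincomb 1 (D p v Y) 1 (D p v Z))) \<and>
     (\<forall>p f Y. smooth_fun A f \<longrightarrow> smooth_vfield A Y \<longrightarrow> (\<forall>v\<in>tangent_space A p.
        D p v (\<lambda>q h. f q * Y q h) = lincomb (v f) (Y p) (f p) (D p v Y)))"

definition levi_civita ::
  "('m, 'e::euclidean_space) chart set \<Rightarrow> 'm metric_field \<Rightarrow> 'm connection \<Rightarrow> bool" where
  "levi_civita A g D \<longleftrightarrow> affine_connection A D \<and>
     (\<forall>p Y Z. smooth_vfield A Y \<longrightarrow> smooth_vfield A Z \<longrightarrow> (\<forall>v\<in>tangent_space A p.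
        v (\<lambda>q. g q (Y q) (Z q)) = g p (D p v Y) (Z p) + g p (Y p) (D p v Z))) \<and>
     (\<forall>p X Y f. smooth_vfield A X \<longrightarrow> smooth_vfield A Y \<longrightarrow> smooth_fun A f \<longrightarrow>
        D p (X p) Y f - D p (Y p) X f = X p (vf_apply Y f) - Y p (vf_apply X f))"

text \<open>The Hessian at \<open>p\<close>, evaluated twice at the tangent vector \<open>v\<close>; \<open>V\<close> is an arbitrary smooth
  extension of \<open>v\<close> (for a torsion-free connection the value does not depend on the choice).\<close>

definition hessian ::
  "('m, 'e::euclidean_space) chart set \<Rightarrow> 'm connection \<Rightarrow> ('m \<Rightarrow> real) \<Rightarrow> 'm \<Rightarrow> 'm tvec \<Rightarrow> real"
  where
  "hessian A D \<phi> p v =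
     (let V = (SOME V. smooth_vfield A V \<and> V p = v)
      in V p (vf_apply V \<phi>) - D p (V p) V \<phi>)"

definition gradient ::
  "('m, 'e::euclidean_space) chart set \<Rightarrow> 'm metric_field \<Rightarrow> ('m \<Rightarrow> real) \<Rightarrow> 'm vfield" where
  "gradient A g f p =
     (THE w. w \<in> tangent_space A p \<and> (\<forall>u\<in>tangent_space A p. g p w u = u f))"

definition cov :: "'m metric_field \<Rightarrow> 'm connection \<Rightarrow> 'm vfield \<Rightarrow> 'm \<Rightarrow> 'm tvec \<Rightarrow> 'm tvec \<Rightarrow> real"
  where "cov g D X p v w = g p (D p v X) w"

definition sym_cov ::
  "'m metric_field \<Rightarrow> 'm connection \<Rightarrow> 'm vfield \<Rightarrow> 'm \<Rightarrow> 'm tvec \<Rightarrow> 'm tvec \<Rightarrow> real" where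
  "sym_cov g D X p v w = 1 / 2 * (cov g D X p v w + cov g D X p w v)"

definition rot ::
  "'m metric_field \<Rightarrow> 'm connection \<Rightarrow> 'm vfield \<Rightarrow> 'm \<Rightarrow> 'm tvec \<Rightarrow> 'm tvec \<Rightarrow> real" where
  "rot g D X p v w = cov g D X p v w - cov g D X p w v"

definition product_atlas ::
  "('m, 'e::euclidean_space) chart set \<Rightarrow> (real \<times> 'm, real \<times> 'e) chart set" where
  "product_atlas A = (\<lambda>(U, c). (UNIV \<times> U, \<lambda>(t, x). (t, c x))) ` A"

text \<open>The tangent vector \<open>\<tau> \<partial>\<^sub>t + v\<close> at \<open>(t, x)\<close>.\<close>

definition product_vec ::
  "('m, 'e::euclidean_space) chart set \<Rightarrow> real \<Rightarrow> 'm \<Rightarrow> real \<Rightarrow> 'm tvec \<Rightarrow> (real \<times> 'm) tvec" where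
  "product_vec A t x \<tau> v = (\<lambda>f. if smooth_fun (product_atlas A) f
     then \<tau> * deriv (\<lambda>s. f (s, x)) t + v (\<lambda>y. f (t, y)) else 0)"

text \<open>The two components \<open>\<tau> = dt(u)\<close> and \<open>v\<close> of a tangent vector \<open>u = \<tau> \<partial>\<^sub>t + v\<close>; the second one is
  the image of \<open>u\<close> under the differential of the projection onto the space factor.\<close>

definition time_comp :: "(real \<times> 'm) tvec \<Rightarrow> real" where
  "time_comp u = u fst"

definition space_comp ::
  "('m, 'e::euclidean_space) chart set \<Rightarrow> (real \<times> 'm) tvec \<Rightarrow> 'm tvec" where
  "space_comp A u = (\<lambda>f. if smooth_fun A f then u (f \<circ> snd) else 0)"

text \<open>The symmetric bilinear form \<open>- \<beta> dt\<^sup>2 + g + 2 g(\<delta>, \<cdot>) dt\<close>.\<close>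

definition stationary_metric ::
  "('m, 'e::euclidean_space) chart set \<Rightarrow> 'm metric_field \<Rightarrow> ('m \<Rightarrow> real) \<Rightarrow> 'm vfield
     \<Rightarrow> (real \<times> 'm) metric_field" where
  "stationary_metric A g \<beta> \<delta> = (\<lambda>(t, x) u w.
     - \<beta> x * time_comp u * time_comp w + g x (space_comp A u) (space_comp A w)
     + time_comp u * g x (\<delta> x) (space_comp A w) + time_comp w * g x (\<delta> x) (space_comp A u))"

end

theory Submission
  imports Defs "HOL-Real_Asymp.Real_Asymp"
begin

text \<open>The coefficients of \<open>W\<close> solve a linear system. Requiring that its product
  with every \<open>u = \<tau>' \<partial>\<^sub>t + u'\<close> equal
  \<open>u' \<phi>\<^sub>0\<close> gives \<open>w + \<sigma> \<delta> = \<nabla> \<phi>\<close> from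
  the part in \<open>u'\<close> and \<open>- \<beta> \<sigma> + g(\<delta>, w) = 0\<close> from the
  part in \<open>\<tau>'\<close>. Eliminating \<open>w\<close> leaves \<open>\<sigma> (\<beta> +
  g(\<delta>, \<delta>)) = \<delta>(\<phi>)\<close>, which is where \<Lambda> comes from. Constant
  time components are chosen because the bracket of two such lifts is the lift of the bracket on the
  space factor, and all inner products of lifts are independent of t. In the Koszul expression the
  derivatives of the auxiliary extension \<open>W\<close> cancel. The extension \<open>V\<close>
  survives only through its own covariant derivative, which is absorbed by the spatial Hessian. The
  remaining derivatives of \<delta> appear antisymmetrised next to the time component of the given
  vector, giving the rotation terms, and evaluated twice at \<open>v\<close> next to \<sigma>,
  giving the symmetric term. The Hessian is defined with an arbitrarily chosen extension, so an
  extension must be shown to exist and the value must be shown not to depend on it.\<close>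

text \<open>Choose a tangent vector \<open>W = \<sigma> \<partial>\<^sub>t + w\<close> at \<open>(t, x)\<close> that is the gradient of \<open>\<phi>\<close> for the stationary
  metric: \<open>\<sigma> = - \<Lambda> \<delta>(\<phi>)\<close> and \<open>w = \<nabla>\<^sup>R \<phi> - \<sigma> \<delta>\<close>. Extend \<open>v\<close> and \<open>w\<close> to fields on \<open>M\<^sub>0\<close> and lift them to the
  product with constant \<open>\<partial>\<^sub>t\<close>-components. The Koszul formula then expresses
  \<open>(\<nabla>\<^bsub>V\<^esub> V) \<phi> = \<langle>\<nabla>\<^bsub>V\<^esub> V, W\<rangle>\<close> through derivatives of functions on \<open>M\<^sub>0\<close>, which metric compatibility of
  \<open>\<nabla>\<^sup>R\<close> turns into the right-hand side. Since tangent vectors are derivations, extending \<open>v\<close> and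
  the existence of gradients rest on Hadamard's lemma and bump functions.\<close>

section \<open>Calculus of \<open>C\<^sup>k\<close> functions\<close>

lemma Ck_on_Suc_has_derivative:
  assumes "Ck_on (Suc k) S f" "x \<in> S"
  shows "(f has_derivative frechet_derivative f (at x)) (at x)"
  using assms by (simp add: frechet_derivative_works)

text \<open>Openness of \<open>S\<close> makes the derivative at a point of \<open>S\<close>
  independent of the values outside \<open>S\<close>.\<close>

lemma Ck_on_cong:
  assumes "open S" "\<And>x. x \<in> S \<Longrightarrow> f x = g x" "Ck_on k S f"
  shows "Ck_on k S g"
  using assms(2,3)
proof (induction k arbitrary: f g)
  case 0
  then show ?case using continuous_on_cong by force
next
  case (Suc k)
  have d: "(g has_derivative frechet_derivative f (at x)) (at x)" if "x \<in> S" for x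
    using Ck_on_Suc_has_derivative[OF Suc.prems(2) that]
    by (rule has_derivative_transform_within_open[OF _ assms(1) that]) (use Suc.prems in auto)
  have "Ck_on k S (\<lambda>x. frechet_derivative g (at x) v)" for v
  proof (rule Suc.IH)
    show "frechet_derivative f (at x) v = frechet_derivative g (at x) v" if "x \<in> S" for x
      using frechet_derivative_at[OF d[OF that]] by simp
    show "Ck_on k S (\<lambda>x. frechet_derivative f (at x) v)" using Suc.prems by simp
  qed
  then show ?case using d by (auto simp: differentiable_def)
qed

text \<open>Lets a proof supply any explicit formula for the derivative; uniqueness of the
  derivative then identifies it with \<open>frechet_derivative\<close>.\<close>

lemma Ck_on_SucI:
  assumes "open S" "\<And>x. x \<in> S \<Longrightarrow> (f has_derivative f' x) (at x)"
    and "\<And>v. Ck_on k S (\<lambda>x. f' x v)"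
  shows "Ck_on (Suc k) S f"
proof -
  have "Ck_on k S (\<lambda>x. frechet_derivative f (at x) v)" for v
    by (rule Ck_on_cong[OF assms(1) _ assms(3)[of v]])
       (use frechet_derivative_at[OF assms(2)] in simp)
  then show ?thesis using assms(2) by (auto simp: differentiable_def)
qed

text \<open>The recursion does not carry the lower orders along, so they have to be recovered; at
  the bottom this is continuity of differentiable functions.\<close>

lemma Ck_on_SucD: "Ck_on (Suc k) S f \<Longrightarrow> Ck_on k S f"
proof (induction k arbitrary: f)
  case 0
  then show ?case
    by (auto intro!: continuous_at_imp_continuous_on differentiable_imp_continuous_within)
next
  case (Suc k)
  have "Ck_on k S (\<lambda>x. frechet_derivative f (at x) v)" for v
    using Suc.prems by (intro Suc.IH) simp
  then show ?case using Suc.prems by simp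
qed

lemma Ck_on_subset: "Ck_on k S f \<Longrightarrow> T \<subseteq> S \<Longrightarrow> Ck_on k T f"
  by (induction k arbitrary: f) (auto intro: continuous_on_subset)

lemma Ck_on_local:
  assumes "\<And>x. x \<in> S \<Longrightarrow> \<exists>T. open T \<and> x \<in> T \<and> Ck_on k T f"
  shows "Ck_on k S f"
  using assms
proof (induction k arbitrary: f)
  case 0
  then have "isCont f x" if "x \<in> S" for x
    using that continuous_on_eq_continuous_at by fastforce
  then show ?case by (simp add: continuous_at_imp_continuous_on)
next
  case (Suc k)
  have "Ck_on k S (\<lambda>x. frechet_derivative f (at x) v)" for v
  proof (rule Suc.IH)
    fix x assume "x \<in> S"
    then obtain T where "open T" "x \<in> T" "Ck_on (Suc k) T f" using Suc.prems by blast
    then show "\<exists>T. open T \<and> x \<in> T \<and> Ck_on k T (\<lambda>x. frechet_derivative f (at x) v)"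
      by (intro exI[of _ T]) simp
  qed
  moreover have "f differentiable (at x)" if "x \<in> S" for x
    using Suc.prems[OF that] by auto
  ultimately show ?case by simp
qed

lemma Ck_on_const: "open S \<Longrightarrow> Ck_on k S (\<lambda>x. c)"
proof (induction k arbitrary: c)
  case (Suc k)
  show ?case by (rule Ck_on_SucI[where f' = "\<lambda>x v. 0"]) (use Suc in auto)
qed simp

lemma Ck_on_bounded_linear:
  assumes "bounded_linear L" "open S"
  shows "Ck_on k S L"
proof (cases k)
  case 0
  then show ?thesis using assms by (simp add: linear_continuous_on)
next
  case (Suc n)
  then show ?thesis
    using assms
    by (auto intro!: Ck_on_SucI[where f' = "\<lambda>x. L"] Ck_on_const bounded_linear_imp_has_derivative simp del: Ck_on.simps)
qed

lemma Ck_on_linear_compose: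
  assumes "bounded_linear L" "open S" "Ck_on k S f"
  shows "Ck_on k S (\<lambda>x. L (f x))"
  using assms(3)
proof (induction k arbitrary: f)
  case 0
  then show ?case using assms by (simp add: bounded_linear.continuous_on)
next
  case (Suc k)
  have "Ck_on k S (\<lambda>x. L (frechet_derivative f (at x) v))" for v
    using Suc.prems by (intro Suc.IH) simp_all
  then show ?case
    using bounded_linear.has_derivative[OF assms(1) Ck_on_Suc_has_derivative] Suc.prems assms(2)
    by (intro Ck_on_SucI[where f' = "\<lambda>x v. L (frechet_derivative f (at x) v)"]) blast+
qed

lemma Ck_on_add:
  assumes "open S" "Ck_on k S f" "Ck_on k S g"
  shows "Ck_on k S (\<lambda>x. f x + g x)"
  using assms(2,3)
proof (induction k arbitrary: f g)
  case 0
  then show ?case by (simp add: continuous_on_add)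
next
  case (Suc k)
  have "Ck_on k S (\<lambda>x. frechet_derivative f (at x) v + frechet_derivative g (at x) v)" for v
    using Suc.prems by (intro Suc.IH) simp_all
  then show ?case
    using has_derivative_add[OF Ck_on_Suc_has_derivative Ck_on_Suc_has_derivative] Suc.prems assms(1)
    by (intro Ck_on_SucI[where
          f' = "\<lambda>x v. frechet_derivative f (at x) v + frechet_derivative g (at x) v"]) blast+
qed

lemma Ck_on_sum:
  assumes "open S" "\<And>i. i \<in> I \<Longrightarrow> Ck_on k S (f i)"
  shows "Ck_on k S (\<lambda>x. \<Sum>i\<in>I. f i x)"
  using assms(2) by (induction I rule: infinite_finite_induct) (auto intro: Ck_on_add Ck_on_const assms(1))

lemma Ck_on_bilinear:
  assumes "bounded_bilinear B" "open S" "Ck_on k S f" "Ck_on k S g"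
  shows "Ck_on k S (\<lambda>x. B (f x) (g x))"
  using assms(3,4)
proof (induction k arbitrary: f g)
  case 0
  then show ?case using assms by (simp add: bounded_bilinear.continuous_on)
next
  case (Suc k)
  have "Ck_on k S (\<lambda>x. B (f x) (frechet_derivative g (at x) v) + B (frechet_derivative f (at x) v) (g x))" for v
    using Suc.prems Ck_on_SucD[OF Suc.prems(1)] Ck_on_SucD[OF Suc.prems(2)]
    by (intro Ck_on_add assms(2) Suc.IH) auto
  then show ?case
    using bounded_bilinear.FDERIV[OF assms(1) Ck_on_Suc_has_derivative Ck_on_Suc_has_derivative] Suc.prems assms(2)
    by (intro Ck_on_SucI[where f' = "\<lambda>x v. B (f x) (frechet_derivative g (at x) v) + B (frechet_derivative f (at x) v) (g x)"]) blast+
qed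

lemma Ck_on_compose:
  fixes f :: "'a::euclidean_space \<Rightarrow> 'b::euclidean_space" and g :: "'b \<Rightarrow> 'c::real_normed_vector"
  assumes "open S" "open T" "f ` S \<subseteq> T" "Ck_on k S f" "Ck_on k T g"
  shows "Ck_on k S (\<lambda>x. g (f x))"
  using assms(4,5)
proof (induction k arbitrary: g)
  case 0
  then show ?case
    using continuous_on_compose2[of T g S f] assms(3) by simp
next
  case (Suc k)
  \<comment> \<open>In the chain rule the derivative of \<open>g\<close> is taken in a direction
    that varies with \<open>x\<close>, whereas the induction hypothesis covers fixed directions
    only. Expanding the direction in the basis turns the expression into a sum of products to which
    it applies.\<close>
  let ?D = "\<lambda>x v. \<Sum>b\<in>Basis. (frechet_derivative f (at x) v \<bullet> b) *\<^sub>R frechet_derivative g (at (f x)) b"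
  show ?case
  proof (rule Ck_on_SucI[OF assms(1), where f' = ?D])
    fix x assume x: "x \<in> S"
    have g: "(g has_derivative frechet_derivative g (at (f x))) (at (f x))"
      by (rule Ck_on_Suc_has_derivative[OF Suc.prems(2)]) (use x assms(3) in auto)
    have lin: "linear (frechet_derivative g (at (f x)))"
      using has_derivative_linear[OF g] .
    have "frechet_derivative g (at (f x)) w = (\<Sum>b\<in>Basis. (w \<bullet> b) *\<^sub>R frechet_derivative g (at (f x)) b)" for w
      using linear_sum[OF lin, of "\<lambda>b. (w \<bullet> b) *\<^sub>R b" Basis]
      by (simp only: euclidean_representation linear_cmul[OF lin])
    then have "?D x = frechet_derivative g (at (f x)) \<circ> frechet_derivative f (at x)"
      unfolding o_def by metis
    moreover have "(g \<circ> f has_derivative \<dots>) (at x)"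
      by (rule diff_chain_at[OF Ck_on_Suc_has_derivative[OF Suc.prems(1) x] g])
    ultimately show "((\<lambda>x. g (f x)) has_derivative ?D x) (at x)" by (simp add: o_def)
  next
    fix v
    show "Ck_on k S (\<lambda>x. ?D x v)"
    proof (intro Ck_on_sum assms(1) Ck_on_bilinear[OF bounded_bilinear_scaleR])
      fix b :: 'b assume "b \<in> Basis"
      show "Ck_on k S (\<lambda>x. frechet_derivative f (at x) v \<bullet> b)"
        using Suc.prems by (intro Ck_on_linear_compose[OF bounded_linear_inner_left] assms(1)) auto
      show "Ck_on k S (\<lambda>x. frechet_derivative g (at (f x)) b)"
        using Suc.prems(2) by (intro Suc.IH[OF Ck_on_SucD[OF Suc.prems(1)]]) simp
    qed
  qed
qed

section \<open>Closure rules for smooth functions, collected over all orders\<close>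

lemma smooth_on_cong: "open S \<Longrightarrow> (\<And>x. x \<in> S \<Longrightarrow> f x = g x) \<Longrightarrow> smooth_on S f \<Longrightarrow> smooth_on S g"
  unfolding smooth_on_def using Ck_on_cong by blast

lemma smooth_on_subset: "smooth_on S f \<Longrightarrow> T \<subseteq> S \<Longrightarrow> smooth_on T f"
  unfolding smooth_on_def using Ck_on_subset by blast

lemma smooth_on_local: "(\<And>x. x \<in> S \<Longrightarrow> \<exists>T. open T \<and> x \<in> T \<and> smooth_on T f) \<Longrightarrow> smooth_on S f"
  unfolding smooth_on_def by (metis Ck_on_local)

lemma smooth_on_const: "open S \<Longrightarrow> smooth_on S (\<lambda>x. c)"
  by (simp add: smooth_on_def Ck_on_const)

lemma smooth_on_bounded_linear: "bounded_linear L \<Longrightarrow> open S \<Longrightarrow> smooth_on S L"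
  by (simp add: smooth_on_def Ck_on_bounded_linear)

lemma smooth_on_linear_compose:
  "bounded_linear L \<Longrightarrow> open S \<Longrightarrow> smooth_on S f \<Longrightarrow> smooth_on S (\<lambda>x. L (f x))"
  by (simp add: smooth_on_def Ck_on_linear_compose)

lemma smooth_on_add: "open S \<Longrightarrow> smooth_on S f \<Longrightarrow> smooth_on S g \<Longrightarrow> smooth_on S (\<lambda>x. f x + g x)"
  by (simp add: smooth_on_def Ck_on_add)

lemma smooth_on_bilinear:
  "bounded_bilinear B \<Longrightarrow> open S \<Longrightarrow> smooth_on S f \<Longrightarrow> smooth_on S g \<Longrightarrow> smooth_on S (\<lambda>x. B (f x) (g x))"
  by (simp add: smooth_on_def Ck_on_bilinear)

lemmas smooth_on_mult = smooth_on_bilinear[OF bounded_bilinear_mult]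
  and smooth_on_inner = smooth_on_bilinear[OF bounded_bilinear_inner]

lemma smooth_on_compose:
  fixes f :: "'a::euclidean_space \<Rightarrow> 'b::euclidean_space"
  shows "open S \<Longrightarrow> open T \<Longrightarrow> f ` S \<subseteq> T \<Longrightarrow> smooth_on S f \<Longrightarrow> smooth_on T g \<Longrightarrow> smooth_on S (\<lambda>x. g (f x))"
  unfolding smooth_on_def using Ck_on_compose[of S T f _ g] by auto

lemma smooth_on_has_derivative:
  "smooth_on S f \<Longrightarrow> x \<in> S \<Longrightarrow> (f has_derivative frechet_derivative f (at x)) (at x)"
  unfolding smooth_on_def using Ck_on_Suc_has_derivative by blast

lemma smooth_on_frechet_derivative: "smooth_on S f \<Longrightarrow> smooth_on S (\<lambda>x. frechet_derivative f (at x) v)"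
  unfolding smooth_on_def by (metis Ck_on.simps(2))

lemma smooth_on_continuous_on: "smooth_on S f \<Longrightarrow> continuous_on S f"
  unfolding smooth_on_def by (metis Ck_on.simps(1))

lemma smooth_on_Pair:
  fixes f :: "'a::euclidean_space \<Rightarrow> 'b::euclidean_space" and g :: "'a \<Rightarrow> 'c::euclidean_space"
  assumes "open S" "smooth_on S f" "smooth_on S g"
  shows "smooth_on S (\<lambda>x. (f x, g x))"
proof -
  have l: "bounded_linear (\<lambda>y::'b. (y, 0::'c))" "bounded_linear (\<lambda>y::'c. (0::'b, y))"
    by (intro bounded_linear_Pair bounded_linear_ident bounded_linear_zero)+
  have "smooth_on S (\<lambda>x. (f x, 0) + (0, g x))"
    by (intro smooth_on_add smooth_on_linear_compose[OF l(1)] smooth_on_linear_compose[OF l(2)] assms)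
  then show ?thesis by simp
qed

section \<open>Hadamard's lemma and bump functions\<close>

lemma segment_mem_ball:
  fixes p :: "'a::euclidean_space"
  assumes "x \<in> ball p r" "0 \<le> s" "s \<le> 1"
  shows "p + s *\<^sub>R (x - p) \<in> ball p r"
proof -
  have "s * norm (x - p) \<le> norm (x - p)" using assms by (simp add: mult_left_le_one_le)
  then show ?thesis using assms by (simp add: dist_norm norm_minus_commute[of p])
qed

lemma continuous_on_segment_family:
  fixes G :: "'a::euclidean_space \<Rightarrow> 'b::real_normed_vector"
  assumes "continuous_on (ball p r) G"
  shows "continuous_on (ball p r \<times> cbox 0 1) (\<lambda>(x, s::real). s ^ n *\<^sub>R G (p + s *\<^sub>R (x - p)))"
proof -
  have "continuous_on (ball p r \<times> cbox 0 1) (\<lambda>z. G (p + snd z *\<^sub>R (fst z - p)))"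
    by (rule continuous_on_compose2[OF assms]) (auto intro!: continuous_intros segment_mem_ball simp del: mem_ball)
  then show ?thesis
    unfolding case_prod_beta by (intro continuous_intros)
qed

text \<open>Differentiation under the integral sign produces a chain rule factor \<open>s\<close>.
  The weight \<open>s ^ n\<close> is left general so that the differentiated integral has the same
  form and the induction closes.\<close>

lemma Ck_on_integral_segment:
  fixes G :: "'a::euclidean_space \<Rightarrow> real"
  assumes "smooth_on (ball p r) G"
  shows "Ck_on k (ball p r) (\<lambda>x. integral (cbox 0 1) (\<lambda>s::real. s ^ n *\<^sub>R G (p + s *\<^sub>R (x - p))))"
  using assms
proof (induction k arbitrary: n G)
  case 0
  then show ?case
    using integral_continuous_on_param[OF continuous_on_segment_family[OF smooth_on_continuous_on]]
    by (simp only: Ck_on.simps)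
next
  case (Suc k)
  define DG where "DG x v = frechet_derivative G (at x) v" for x v
  have DG: "(G has_derivative DG y) (at y)" if "y \<in> ball p r" for y
    unfolding DG_def using smooth_on_has_derivative[OF Suc.prems that] .
  have contDG: "continuous_on (ball p r) (\<lambda>y. DG y v)" for v
    unfolding DG_def using smooth_on_continuous_on[OF smooth_on_frechet_derivative[OF Suc.prems]] .
  \<comment> \<open>The Leibniz rule for parametric integrals expects the derivative as a bounded
    linear function depending jointly continuously on parameter and integration variable; that
    continuity is checked one direction at a time.\<close>
  define F where "F x s = Blinfun (\<lambda>v. s ^ Suc n *\<^sub>R DG (p + s *\<^sub>R (x - p)) v)" for x and s :: real
  have F: "blinfun_apply (F x s) = (\<lambda>v. s ^ Suc n *\<^sub>R DG (p + s *\<^sub>R (x - p)) v)"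
    if "x \<in> ball p r" "s \<in> cbox 0 1" for x s
    unfolding F_def using that
    by (intro bounded_linear_Blinfun_apply bounded_linear_const_scaleR has_derivative_bounded_linear[OF DG] segment_mem_ball) auto
  have contF: "continuous_on (ball p r \<times> cbox 0 1) (\<lambda>(x, s). F x s)"
  proof (rule continuous_on_blinfun_componentwise)
    fix v :: 'a
    have "continuous_on (ball p r \<times> cbox 0 1) (\<lambda>(x, s). s ^ Suc n *\<^sub>R DG (p + s *\<^sub>R (x - p)) v)"
      by (rule continuous_on_segment_family[OF contDG])
    then show "continuous_on (ball p r \<times> cbox 0 1) (\<lambda>z. blinfun_apply (case z of (x, s) \<Rightarrow> F x s) v)"
      by (rule continuous_on_eq) (use F in auto)
  qed
  let ?I = "\<lambda>x. integral (cbox 0 1) (\<lambda>s::real. s ^ n *\<^sub>R G (p + s *\<^sub>R (x - p)))"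
  have der: "(?I has_derivative (\<lambda>v. integral (cbox 0 1) (\<lambda>s::real. s ^ Suc n *\<^sub>R DG (p + s *\<^sub>R (x - p)) v))) (at x)"
    if x: "x \<in> ball p r" for x
  proof -
    have d: "((\<lambda>x. s ^ n *\<^sub>R G (p + s *\<^sub>R (x - p))) has_derivative blinfun_apply (F y s)) (at y within ball p r)"
      if y: "y \<in> ball p r" and s: "s \<in> cbox 0 1" for y s
    proof -
      have lin: "linear (DG (p + s *\<^sub>R (y - p)))"
        by (intro has_derivative_linear[OF DG] segment_mem_ball) (use y s in auto)
      have "((\<lambda>x. G (p + s *\<^sub>R (x - p))) has_derivative (\<lambda>v. DG (p + s *\<^sub>R (y - p)) (s *\<^sub>R v))) (at y)"
        by (rule has_derivative_compose[of "\<lambda>x. p + s *\<^sub>R (x - p)", OF _ DG])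
           (use segment_mem_ball y s in \<open>auto intro!: derivative_eq_intros\<close>)
      then have "((\<lambda>x. s ^ n *\<^sub>R G (p + s *\<^sub>R (x - p))) has_derivative
          (\<lambda>v. s ^ n *\<^sub>R DG (p + s *\<^sub>R (y - p)) (s *\<^sub>R v))) (at y)"
        by (rule has_derivative_scaleR_right)
      moreover have "(\<lambda>v. s ^ n *\<^sub>R DG (p + s *\<^sub>R (y - p)) (s *\<^sub>R v)) = blinfun_apply (F y s)"
        unfolding F[OF y s] linear_cmul[OF lin] by (simp add: mult_ac)
      ultimately show ?thesis by (simp add: has_derivative_at_withinI)
    qed
    have int: "(\<lambda>s::real. s ^ n *\<^sub>R G (p + s *\<^sub>R (y - p))) integrable_on cbox 0 1" if "y \<in> ball p r" for y
    proof (rule integrable_continuous)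
      have "continuous_on (cbox 0 1) (\<lambda>s. (\<lambda>(x, s::real). s ^ n *\<^sub>R G (p + s *\<^sub>R (x - p))) (y, s))"
        by (rule continuous_on_compose2[OF continuous_on_segment_family[OF smooth_on_continuous_on[OF Suc.prems]]])
           (use that in \<open>auto intro!: continuous_intros\<close>)
      then show "continuous_on (cbox 0 1) (\<lambda>s::real. s ^ n *\<^sub>R G (p + s *\<^sub>R (y - p)))" by simp
    qed
    have "(?I has_derivative integral (cbox 0 1) (F x)) (at x within ball p r)"
      by (rule leibniz_rule[OF d int contF x convex_ball])
    moreover have "blinfun_apply (integral (cbox 0 1) (F x)) v
        = integral (cbox 0 1) (\<lambda>s::real. s ^ Suc n *\<^sub>R DG (p + s *\<^sub>R (x - p)) v)" for v
    proof -
      have "continuous_on (cbox 0 1) (\<lambda>s. (\<lambda>(x, s). F x s) (x, s))"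
        by (rule continuous_on_compose2[OF contF]) (use x in \<open>auto intro!: continuous_intros\<close>)
      then have "F x integrable_on cbox 0 1"
        using integrable_continuous[of 0 1 "F x"] by simp
      then have "blinfun_apply (integral (cbox 0 1) (F x)) v = integral (cbox 0 1) (\<lambda>s. F x s v)"
        using blinfun_apply_integral by blast
      also have "\<dots> = integral (cbox 0 1) (\<lambda>s::real. s ^ Suc n *\<^sub>R DG (p + s *\<^sub>R (x - p)) v)"
        by (rule integral_cong) (use F[OF x] in auto)
      finally show ?thesis .
    qed
    ultimately show ?thesis
      unfolding at_within_open[OF x open_ball] by (metis (no_types, lifting) ext)
  qed
  have "Ck_on k (ball p r) (\<lambda>x. integral (cbox 0 1) (\<lambda>s::real. s ^ Suc n *\<^sub>R DG (p + s *\<^sub>R (x - p)) v))" for v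
    by (rule Suc.IH) (unfold DG_def, rule smooth_on_frechet_derivative[OF Suc.prems])
  with der show ?case by (intro Ck_on_SucI[OF open_ball]) blast+
qed

text \<open>Integrate the derivative of \<open>f\<close> along the segment from \<open>p\<close> to
  \<open>x\<close> and expand the direction \<open>x - p\<close> in the basis; \<open>h b\<close> is
  the average of the partial derivative over the segment.\<close>

lemma hadamard:
  fixes f :: "'a::euclidean_space \<Rightarrow> real"
  assumes "smooth_on (ball p r) f" "0 < r"
  obtains h where "\<And>b. smooth_on (ball p r) (h b)"
    and "\<And>b. h b p = frechet_derivative f (at p) b"
    and "\<And>x. x \<in> ball p r \<Longrightarrow> f x = f p + (\<Sum>b\<in>Basis. ((x - p) \<bullet> b) * h b x)"
proof
  let ?D = "\<lambda>x v. frechet_derivative f (at x) v"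
  \<comment> \<open>The factor \<open>s ^ 0\<close> makes this the weight-zero member of the family
    in \<open>Ck_on_integral_segment\<close>.\<close>
  define h where "h b x = integral (cbox 0 1) (\<lambda>s::real. s ^ 0 *\<^sub>R ?D (p + s *\<^sub>R (x - p)) b)" for b x
  show "smooth_on (ball p r) (h b)" for b
    unfolding smooth_on_def h_def
    using Ck_on_integral_segment[OF smooth_on_frechet_derivative[OF assms(1)]] by blast
  show "h b p = ?D p b" for b
    by (simp add: h_def)
  fix x assume x: "x \<in> ball p r"
  have mem: "p + s *\<^sub>R (x - p) \<in> ball p r" if "s \<in> {0..1}" for s
    using segment_mem_ball[OF x] that by auto
  have der: "((\<lambda>s. f (p + s *\<^sub>R (x - p))) has_vector_derivative ?D (p + s *\<^sub>R (x - p)) (x - p)) (at s within {0..1})"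
    if "s \<in> {0..1}" for s
  proof -
    have lin: "linear (?D (p + s *\<^sub>R (x - p)))"
      using has_derivative_linear[OF smooth_on_has_derivative[OF assms(1) mem[OF that]]] .
    have "((\<lambda>s. f (p + s *\<^sub>R (x - p))) has_derivative (\<lambda>u. ?D (p + s *\<^sub>R (x - p)) (u *\<^sub>R (x - p)))) (at s)"
      by (rule has_derivative_compose[of "\<lambda>s. p + s *\<^sub>R (x - p)", OF _ smooth_on_has_derivative[OF assms(1) mem[OF that]]])
         (auto intro!: derivative_eq_intros)
    then show ?thesis
      unfolding has_vector_derivative_def linear_cmul[OF lin] by (rule has_derivative_at_withinI)
  qed
  have int: "((\<lambda>s. ?D (p + s *\<^sub>R (x - p)) b) has_integral h b x) {0..1}" for b
  proof -
    have "continuous_on {0..1} (\<lambda>s::real. ?D (p + s *\<^sub>R (x - p)) b)"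
      by (rule continuous_on_compose2[OF smooth_on_continuous_on[OF smooth_on_frechet_derivative[OF assms(1)]]])
         (use mem in \<open>auto intro!: continuous_intros simp del: mem_ball\<close>)
    then show ?thesis
      unfolding h_def by (simp add: integrable_integral integrable_continuous_real)
  qed
  have "((\<lambda>s. ?D (p + s *\<^sub>R (x - p)) (x - p)) has_integral (f x - f p)) {0..1}"
    using fundamental_theorem_of_calculus[OF _ der] by simp
  moreover have "((\<lambda>s. ?D (p + s *\<^sub>R (x - p)) (x - p)) has_integral (\<Sum>b\<in>Basis. ((x - p) \<bullet> b) * h b x)) {0..1}"
  proof (rule has_integral_eq)
    show "((\<lambda>s. \<Sum>b\<in>Basis. ((x - p) \<bullet> b) * ?D (p + s *\<^sub>R (x - p)) b) has_integral
        (\<Sum>b\<in>Basis. ((x - p) \<bullet> b) * h b x)) {0..1}"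
      by (intro has_integral_sum has_integral_mult_right int) simp
    fix s :: real assume "s \<in> {0..1}"
    then have lin: "linear (?D (p + s *\<^sub>R (x - p)))"
      using has_derivative_linear[OF smooth_on_has_derivative[OF assms(1) mem]] by blast
    show "(\<Sum>b\<in>Basis. ((x - p) \<bullet> b) * ?D (p + s *\<^sub>R (x - p)) b) = ?D (p + s *\<^sub>R (x - p)) (x - p)"
      using linear_sum[OF lin, of "\<lambda>b. ((x - p) \<bullet> b) *\<^sub>R b" Basis]
      by (simp only: euclidean_representation linear_cmul[OF lin] real_scaleR_def)
  qed
  ultimately have "f x - f p = (\<Sum>b\<in>Basis. ((x - p) \<bullet> b) * h b x)"
    by (rule has_integral_unique)
  then show "f x = f p + (\<Sum>b\<in>Basis. ((x - p) \<bullet> b) * h b x)" by simp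
qed

text \<open>The classical flat function exp(-1/x), multiplied by powers of 1/x and extended by zero.
  The powers are included because derivatives of members of this family are linear combinations of
  members.\<close>

definition flat_exp :: "nat \<Rightarrow> real \<Rightarrow> real" where
  "flat_exp n x = (if x \<le> 0 then 0 else exp (- inverse x) * inverse x ^ n)"

lemma flat_exp_tendsto: "(flat_exp n \<longlongrightarrow> 0) (at 0)"
proof -
  have "((\<lambda>x. exp (- inverse x) * inverse x ^ n) \<longlongrightarrow> 0) (at_right (0::real))"
    by real_asymp
  then have "(flat_exp n \<longlongrightarrow> 0) (at_right 0)"
    by (rule Lim_transform_eventually)
       (auto simp: flat_exp_def eventually_at_filter intro!: always_eventually)
  moreover have "(flat_exp n \<longlongrightarrow> 0) (at_left 0)"
    by (rule Lim_transform_eventually[OF tendsto_const])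
       (auto simp: flat_exp_def eventually_at_filter intro!: always_eventually)
  ultimately show ?thesis
    by (simp add: filterlim_at_split)
qed

lemma flat_exp_DERIV:
  "(flat_exp n has_real_derivative flat_exp (n + 2) x - real n * flat_exp (n + 1) x) (at x)"
proof (cases x "0::real" rule: linorder_cases)
  case less
  have "((\<lambda>x. 0) has_real_derivative 0) (at x)" by simp
  then have "(flat_exp n has_real_derivative 0) (at x)"
    by (rule has_field_derivative_transform_within_open[of _ _ _ "{..<0}"]) (use less in \<open>auto simp: flat_exp_def\<close>)
  then show ?thesis using less by (simp add: flat_exp_def)
next
  case equal
  \<comment> \<open>Dividing by \<open>h\<close> raises the index by one, so the difference quotient
    at 0 is \<open>flat_exp (Suc n)\<close>, which tends to 0.\<close>
  have "((\<lambda>h. (flat_exp n (0 + h) - flat_exp n 0) / h) \<longlongrightarrow> 0) (at 0)"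
    by (rule Lim_transform_eventually[OF flat_exp_tendsto[of "Suc n"]])
       (auto simp: flat_exp_def divide_inverse)
  then show ?thesis using equal by (simp add: DERIV_def flat_exp_def)
next
  case greater
  have inv: "((\<lambda>x. inverse x) has_real_derivative - (inverse x ^ 2)) (at x)"
    using DERIV_inverse[of x UNIV] greater by (simp add: numeral_2_eq_2)
  have d: "((\<lambda>x. exp (- inverse x) * inverse x ^ n) has_real_derivative
      exp (- inverse x) * inverse x ^ 2 * inverse x ^ n
      - exp (- inverse x) * (real n * inverse x ^ (n - 1) * inverse x ^ 2)) (at x)"
    by (rule derivative_eq_intros inv refl)+ (simp add: algebra_simps)
  \<comment> \<open>For \<open>n = 0\<close> the truncated exponent \<open>n - 1\<close> does no
    harm, because the factor \<open>real n\<close> vanishes.\<close>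
  have m: "real n * inverse x ^ (n - 1) * inverse x ^ 2 = real n * inverse x ^ (n + 1)"
    by (cases n) (auto simp: power2_eq_square)
  have "((\<lambda>x. exp (- inverse x) * inverse x ^ n) has_real_derivative
      exp (- inverse x) * inverse x ^ (n + 2) - real n * (exp (- inverse x) * inverse x ^ (n + 1))) (at x)"
    using d unfolding m by (simp add: power_add mult_ac power2_eq_square)
  then have "(flat_exp n has_real_derivative
      exp (- inverse x) * inverse x ^ (n + 2) - real n * (exp (- inverse x) * inverse x ^ (n + 1))) (at x)"
    by (rule has_field_derivative_transform_within_open[of _ _ _ "{0<..}"]) (use greater in \<open>auto simp: flat_exp_def\<close>)
  then show ?thesis using greater by (simp add: flat_exp_def)
qed

lemma smooth_on_flat_exp: "smooth_on UNIV (flat_exp n)"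
proof -
  have "Ck_on k UNIV (flat_exp n)" for k
  proof (induction k arbitrary: n)
    case 0
    then show ?case
      using DERIV_isCont[OF flat_exp_DERIV] by (auto intro!: continuous_at_imp_continuous_on)
  next
    case (Suc k)
    show ?case
    proof (rule Ck_on_SucI)
      show "(flat_exp n has_derivative
          (\<lambda>v. v * (flat_exp (n + 2) x + - real n * flat_exp (n + 1) x))) (at x)" for x
        using flat_exp_DERIV[of n x] unfolding has_field_derivative_def
        by (rule has_derivative_eq_rhs) (simp add: fun_eq_iff algebra_simps)
      show "Ck_on k UNIV (\<lambda>x. v * (flat_exp (n + 2) x + - real n * flat_exp (n + 1) x))" for v
        by (intro Ck_on_linear_compose[OF bounded_linear_mult_right] Ck_on_add Suc.IH open_UNIV)
    qed simp
  qed
  then show ?thesis by (simp add: smooth_on_def)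
qed

text \<open>The flat function is composed with the polynomial
  \<open>r\<^sup>2 - |x - p|\<^sup>2\<close>, which is positive exactly inside the ball, and
  normalised by its value at the centre.\<close>

lemma smooth_bump:
  fixes p :: "'a::euclidean_space"
  assumes "0 < r"
  obtains \<psi> :: "'a \<Rightarrow> real" where "smooth_on UNIV \<psi>" "\<psi> p = 1" "\<And>x. x \<notin> cball p r \<Longrightarrow> \<psi> x = 0"
proof
  let ?q = "\<lambda>x::'a. r\<^sup>2 + - ((x - p) \<bullet> (x - p))"
  let ?\<psi> = "\<lambda>x. inverse (flat_exp 0 (r\<^sup>2)) * flat_exp 0 (?q x)"
  have id: "smooth_on UNIV (\<lambda>x::'a. x + - p)"
    by (intro smooth_on_add smooth_on_const smooth_on_bounded_linear bounded_linear_ident open_UNIV)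
  have "smooth_on UNIV ?q"
    using smooth_on_inner[OF open_UNIV id id]
    by (intro smooth_on_add smooth_on_const smooth_on_linear_compose[OF bounded_linear_minus[OF bounded_linear_ident]] open_UNIV) simp
  then show "smooth_on UNIV ?\<psi>"
    by (intro smooth_on_mult smooth_on_const open_UNIV smooth_on_compose[OF _ _ _ _ smooth_on_flat_exp]) auto
  show "?\<psi> p = 1"
    using assms by (simp add: flat_exp_def)
  show "?\<psi> x = 0" if "x \<notin> cball p r" for x
  proof -
    have "r < norm (x - p)" using that by (simp add: dist_norm norm_minus_commute)
    then have "r\<^sup>2 \<le> norm (x - p) ^ 2" using assms by (intro power_mono) auto
    then show ?thesis by (simp add: flat_exp_def power2_norm_eq_inner)
  qed
qed

section \<open>Tangent vectors in charts\<close>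

locale smooth_manifold =
  fixes A :: "('m::{t2_space, second_countable_topology}, 'e::euclidean_space) chart set"
  assumes atlas: "smooth_atlas A"
begin

lemma chart_exists: obtains U c where "(U, c) \<in> A" "p \<in> U"
proof -
  have "p \<in> \<Union>(fst ` A)" using atlas unfolding smooth_atlas_def by blast
  then show ?thesis using that by force
qed

lemma chart_homeomorphism:
  assumes "(U, c) \<in> A"
  shows "open U" "open (c ` U)" "homeomorphism U (c ` U) c (inv_into U c)"
  using atlas assms unfolding smooth_atlas_def is_chart_def by auto

lemma chart_inverse:
  assumes "(U, c) \<in> A"
  shows "q \<in> U \<Longrightarrow> inv_into U c (c q) = q"
    and "e \<in> c ` U \<Longrightarrow> inv_into U c e \<in> U"
    and "e \<in> c ` U \<Longrightarrow> c (inv_into U c e) = e"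
    and "inj_on c U"
  using chart_homeomorphism(3)[OF assms]
  by (auto simp: homeomorphism_def inv_into_into f_inv_into_f intro: inj_on_inverseI)

lemma chart_open_image:
  assumes "(U, c) \<in> A" "open W" "W \<subseteq> U"
  shows "open (c ` W)"
  using homeomorphism_imp_open_map[OF chart_homeomorphism(3)[OF assms(1)], of W] assms
    chart_homeomorphism[OF assms(1)]
  by (simp add: openin_open_eq)

lemma chart_open_preimage:
  assumes "(U, c) \<in> A" "open W" "W \<subseteq> c ` U"
  shows "open (inv_into U c ` W)"
  using homeomorphism_imp_open_map[OF homeomorphism_symD[OF chart_homeomorphism(3)[OF assms(1)]], of W] assms
    chart_homeomorphism[OF assms(1)]
  by (simp add: openin_open_eq)

text \<open>The set is the image of a compact set under the inverse chart, hence compact, and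
  compact sets are closed in a Hausdorff space. Without closedness, extension by zero could fail to
  be smooth at limit points outside the chart.\<close>

lemma closed_chart_compact:
  assumes "(U, c) \<in> A" "compact K" "K \<subseteq> c ` U"
  shows "closed {q \<in> U. c q \<in> K}"
proof -
  have "{q \<in> U. c q \<in> K} = inv_into U c ` K"
  proof (intro equalityI subsetI)
    fix q assume "q \<in> {q \<in> U. c q \<in> K}"
    then show "q \<in> inv_into U c ` K"
      using chart_inverse(1)[OF assms(1), of q] by (metis (mono_tags, lifting) imageI mem_Collect_eq)
  next
    fix q assume "q \<in> inv_into U c ` K"
    then show "q \<in> {q \<in> U. c q \<in> K}"
      using chart_inverse(2,3)[OF assms(1)] assms(3) by auto
  qed
  moreover have "continuous_on K (inv_into U c)"
    using chart_homeomorphism(3)[OF assms(1)] assms(3) by (auto simp: homeomorphism_def intro: continuous_on_subset)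
  ultimately show ?thesis
    using compact_continuous_image[OF _ assms(2)] compact_imp_closed by metis
qed

lemma transition_smooth:
  assumes "(U, c) \<in> A" "(V, d) \<in> A"
  shows "smooth_on (c ` (U \<inter> V)) (\<lambda>x. d (inv_into U c x))"
proof -
  have "compatible (U, c) (V, d)" using atlas assms unfolding smooth_atlas_def by blast
  then show ?thesis by (simp add: compatible_def o_def)
qed

lemma smooth_fun_chart:
  assumes "smooth_fun A f" "(U, c) \<in> A"
  shows "smooth_on (c ` U) (\<lambda>x. f (inv_into U c x))"
  using assms unfolding smooth_fun_def by (auto simp: o_def)

text \<open>\<open>smooth_fun\<close> quantifies over all charts of the atlas. One chart around each
  point is enough, since the others differ from it by smooth transition maps.\<close>

lemma smooth_fun_localI:
  assumes "\<And>p. \<exists>U c W. (U, c) \<in> A \<and> p \<in> U \<and> open W \<and> c p \<in> W \<and> W \<subseteq> c ` U \<and>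
      smooth_on W (\<lambda>x. f (inv_into U c x))"
  shows "smooth_fun A f"
proof -
  have "smooth_on (d ` V) (\<lambda>x. f (inv_into V d x))" if V: "(V, d) \<in> A" for V d
  proof (rule smooth_on_local)
    fix x assume "x \<in> d ` V"
    then obtain q where q: "q \<in> V" "x = d q" by blast
    obtain U c W where U: "(U, c) \<in> A" "q \<in> U" and W: "open W" "c q \<in> W" "W \<subseteq> c ` U"
      and f: "smooth_on W (\<lambda>x. f (inv_into U c x))"
      using assms[of q] by (elim exE conjE) (rule that)
    let ?N = "V \<inter> inv_into U c ` W"
    have N: "open ?N" "?N \<subseteq> V"
      using chart_open_preimage[OF U(1) W(1,3)] chart_homeomorphism(1)[OF V] by auto
    have N': "q \<in> ?N" "?N \<subseteq> V \<inter> U"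
      using q(1) imageI[OF W(2), of "inv_into U c"] chart_inverse(1)[OF U] chart_inverse(2)[OF U(1)] W(3) by auto
    have T: "open (d ` ?N)" using chart_open_image[OF V N(1,2)] .
    have c: "c (inv_into V d y) \<in> W" "inv_into V d y \<in> U" if "y \<in> d ` ?N" for y
      using that chart_inverse[OF V] chart_inverse[OF U(1)] W(3) by auto
    have "smooth_on (d ` ?N) (\<lambda>x. c (inv_into V d x))"
      using transition_smooth[OF V U(1)] by (rule smooth_on_subset) (use N'(2) in blast)
    then have "smooth_on (d ` ?N) (\<lambda>y. f (inv_into U c (c (inv_into V d y))))"
      by (intro smooth_on_compose[OF T W(1) _ _ f]) (use c in auto)
    then have "smooth_on (d ` ?N) (\<lambda>y. f (inv_into V d y))"
      by (rule smooth_on_cong[OF T, rotated]) (use c(2) chart_inverse(1)[OF U(1)] in simp)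
    then show "\<exists>T. open T \<and> x \<in> T \<and> smooth_on T (\<lambda>x. f (inv_into V d x))"
      using T N'(1) q(2) by blast
  qed
  then show ?thesis unfolding smooth_fun_def by (auto simp: o_def)
qed

lemma smooth_fun_const: "smooth_fun A (\<lambda>q. k)"
  using chart_homeomorphism(2) by (auto simp: smooth_fun_def o_def intro: smooth_on_const)

lemma smooth_fun_add: "smooth_fun A f \<Longrightarrow> smooth_fun A g \<Longrightarrow> smooth_fun A (\<lambda>q. f q + g q)"
  using chart_homeomorphism(2) smooth_fun_chart
  by (auto simp: smooth_fun_def o_def intro!: smooth_on_add)

lemma smooth_fun_mult: "smooth_fun A f \<Longrightarrow> smooth_fun A g \<Longrightarrow> smooth_fun A (\<lambda>q. f q * g q)"
  using chart_homeomorphism(2) smooth_fun_chart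
  by (auto simp: smooth_fun_def o_def intro!: smooth_on_mult)

lemma smooth_fun_sum:
  "(\<And>i. i \<in> I \<Longrightarrow> smooth_fun A (f i)) \<Longrightarrow> smooth_fun A (\<lambda>q. \<Sum>i\<in>I. f i q)"
  by (induction I rule: infinite_finite_induct) (auto intro: smooth_fun_add smooth_fun_const)

section \<open>Algebraic rules for derivations at a point\<close>

lemma tangent_lincomb:
  assumes "v \<in> tangent_space A p" "smooth_fun A f" "smooth_fun A g"
  shows "v (\<lambda>q. a * f q + b * g q) = a * v f + b * v g"
  using assms unfolding tangent_space_def by blast

lemma tangent_add:
  assumes "v \<in> tangent_space A p" "smooth_fun A f" "smooth_fun A g"
  shows "v (\<lambda>q. f q + g q) = v f + v g"
  using tangent_lincomb[OF assms, of 1 1] by simp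

lemma tangent_mult:
  assumes "v \<in> tangent_space A p" "smooth_fun A f" "smooth_fun A g"
  shows "v (\<lambda>q. f q * g q) = f p * v g + g p * v f"
  using assms unfolding tangent_space_def by blast

lemma tangent_nonsmooth: "v \<in> tangent_space A p \<Longrightarrow> \<not> smooth_fun A f \<Longrightarrow> v f = 0"
  unfolding tangent_space_def by blast

lemma tangent_const:
  assumes "v \<in> tangent_space A p"
  shows "v (\<lambda>q. k) = 0"
proof -
  \<comment> \<open>The product rule for 1 = 1 * 1 reads v(1) = 2 v(1).\<close>
  have "v (\<lambda>q. 1) = 0"
    using tangent_mult[OF assms smooth_fun_const[of 1] smooth_fun_const[of 1]] by simp
  then show ?thesis
    using tangent_lincomb[OF assms smooth_fun_const[of 1] smooth_fun_const[of 1], of k 0] by simp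
qed

lemma tangent_scale:
  assumes "v \<in> tangent_space A p" "smooth_fun A f"
  shows "v (\<lambda>q. a * f q) = a * v f"
  using tangent_lincomb[OF assms assms(2), of a 0] by simp

lemma tangent_sum:
  assumes "v \<in> tangent_space A p" "\<And>i. i \<in> I \<Longrightarrow> smooth_fun A (f i)"
  shows "v (\<lambda>q. \<Sum>i\<in>I. f i q) = (\<Sum>i\<in>I. v (f i))"
  using assms(2)
  by (induction I rule: infinite_finite_induct)
     (auto simp: tangent_const[OF assms(1)] tangent_add[OF assms(1)] smooth_fun_sum)

lemma lincomb_tangent:
  assumes "v \<in> tangent_space A p" "w \<in> tangent_space A p"
  shows "lincomb a v b w \<in> tangent_space A p"
  unfolding tangent_space_def lincomb_def
  by (auto simp: tangent_lincomb[OF assms(1)] tangent_lincomb[OF assms(2)] tangent_mult[OF assms(1)]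
      tangent_mult[OF assms(2)] tangent_nonsmooth[OF assms(1)] tangent_nonsmooth[OF assms(2)] algebra_simps)

text \<open>Two open sets cover the manifold: the part of \<open>U\<close> over \<open>W\<close>,
  where the function is \<open>F\<close> in the chart, and the complement of the closed set over
  \<open>K\<close>, where it vanishes identically. They overlap in a region where \<open>F\<close>
  is zero.\<close>

lemma smooth_fun_extend_by_zero:
  assumes "(U, c) \<in> A" "open W" "W \<subseteq> c ` U" "smooth_on W F"
    and "closed {q \<in> U. c q \<in> K}" "K \<subseteq> W" "\<And>x. x \<in> W - K \<Longrightarrow> F x = 0"
  shows "smooth_fun A (\<lambda>q. if q \<in> U \<and> c q \<in> W then F (c q) else 0)" (is "smooth_fun A ?f")
proof (rule smooth_fun_localI)
  fix p
  let ?C = "{q \<in> U. c q \<in> K}"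
  show "\<exists>U c W. (U, c) \<in> A \<and> p \<in> U \<and> open W \<and> c p \<in> W \<and> W \<subseteq> c ` U \<and> smooth_on W (\<lambda>x. ?f (inv_into U c x))"
  proof (cases "p \<in> U \<and> c p \<in> W")
    case True
    have "smooth_on W (\<lambda>x. ?f (inv_into U c x))"
      using assms(4) by (rule smooth_on_cong[OF assms(2), rotated])
        (use chart_inverse[OF assms(1)] assms(3) in auto)
    then show ?thesis using True assms by blast
  next
    case False
    obtain V d where V: "(V, d) \<in> A" "p \<in> V" using chart_exists .
    have o: "open (d ` (V - ?C))"
      using assms(5) chart_homeomorphism(1)[OF V(1)] by (intro chart_open_image[OF V(1)]) auto
    have z: "0 = ?f (inv_into V d x)" if "x \<in> d ` (V - ?C)" for x
    proof -
      have "inv_into V d x \<notin> ?C" using that chart_inverse(1)[OF V(1)] by auto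
      then show ?thesis using assms(7) by auto
    qed
    have "smooth_on (d ` (V - ?C)) (\<lambda>x. ?f (inv_into V d x))"
      by (rule smooth_on_cong[OF o z smooth_on_const[OF o]])
    moreover have "d p \<in> d ` (V - ?C)" using False V assms(6) by blast
    ultimately show ?thesis using V o by blast
  qed
qed

text \<open>The directional derivative in the coordinate direction \<open>a\<close>. The default 0
  on functions that are not smooth follows the convention of \<open>tangent_space\<close>, so that
  equality of derivations can be proved as equality of functions.\<close>

definition coord_vec :: "'m set \<Rightarrow> ('m \<Rightarrow> 'e) \<Rightarrow> 'e \<Rightarrow> 'm vfield" where
  "coord_vec U c a q = (\<lambda>f. if smooth_fun A f
     then frechet_derivative (\<lambda>x. f (inv_into U c x)) (at (c q)) a else 0)"

lemma smooth_fun_has_derivative: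
  assumes "smooth_fun A f" "(U, c) \<in> A" "e \<in> c ` U"
  shows "((\<lambda>x. f (inv_into U c x)) has_derivative frechet_derivative (\<lambda>x. f (inv_into U c x)) (at e)) (at e)"
  using smooth_on_has_derivative[OF smooth_fun_chart[OF assms(1,2)] assms(3)] .

lemma coord_vec_tangent:
  assumes "(U, c) \<in> A" "q \<in> U"
  shows "coord_vec U c a q \<in> tangent_space A q"
proof -
  note d = smooth_fun_has_derivative[OF _ assms(1) imageI[OF assms(2)]]
  have lc: "coord_vec U c a q (\<lambda>q. k * f q + l * g q) = k * coord_vec U c a q f + l * coord_vec U c a q g"
    if f: "smooth_fun A f" and g: "smooth_fun A g" for f g k l
  proof -
    have "smooth_fun A (\<lambda>q. k * f q + l * g q)"
      by (intro smooth_fun_add smooth_fun_mult smooth_fun_const f g)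
    then show ?thesis
      using frechet_derivative_at[OF has_derivative_add[OF has_derivative_mult_right[OF d[OF f], of k]
            has_derivative_mult_right[OF d[OF g], of l]]] f g
      by (simp add: coord_vec_def fun_eq_iff)
  qed
  have mult: "coord_vec U c a q (\<lambda>q. f q * g q) = f q * coord_vec U c a q g + g q * coord_vec U c a q f"
    if f: "smooth_fun A f" and g: "smooth_fun A g" for f g
    using fun_cong[OF frechet_derivative_at[OF has_derivative_mult[OF d[OF f] d[OF g]]], of a]
      f g smooth_fun_mult[OF f g] chart_inverse(1)[OF assms]
    by (simp add: coord_vec_def mult.commute)
  show ?thesis
    unfolding tangent_space_def using lc mult by (simp add: coord_vec_def)
qed

lemma coord_vec_lincomb:
  assumes "(U, c) \<in> A" "q \<in> U"
  shows "coord_vec U c (k *\<^sub>R a + l *\<^sub>R b) q = lincomb k (coord_vec U c a q) l (coord_vec U c b q)"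
proof
  fix f
  show "coord_vec U c (k *\<^sub>R a + l *\<^sub>R b) q f = lincomb k (coord_vec U c a q) l (coord_vec U c b q) f"
  proof (cases "smooth_fun A f")
    case True
    note lin = has_derivative_linear[OF smooth_fun_has_derivative[OF True assms(1) imageI[OF assms(2)]]]
    show ?thesis
      using True by (simp add: coord_vec_def lincomb_def linear_add[OF lin] linear_cmul[OF lin])
  qed (simp add: coord_vec_def lincomb_def)
qed

text \<open>Halving the radius puts the closed ball that carries the bump inside the open ball on
  which local functions are given, as extension by zero requires.\<close>

lemma bump_at_chart_point:
  assumes "(U, c) \<in> A" "p \<in> U"
  obtains \<psi> :: "'e \<Rightarrow> real" and r where "0 < r" "ball (c p) r \<subseteq> c ` U" "smooth_on UNIV \<psi>" "\<psi> (c p) = 1"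
    "\<And>x. x \<notin> cball (c p) (r / 2) \<Longrightarrow> \<psi> x = 0"
    "closed {q \<in> U. c q \<in> cball (c p) (r / 2)}" "cball (c p) (r / 2) \<subseteq> ball (c p) r"
proof -
  obtain r where r: "0 < r" "ball (c p) r \<subseteq> c ` U"
    using chart_homeomorphism(2)[OF assms(1)] assms(2) by (meson imageI openE)
  obtain \<psi> :: "'e \<Rightarrow> real" where "smooth_on UNIV \<psi>" "\<psi> (c p) = 1" "\<And>x. x \<notin> cball (c p) (r / 2) \<Longrightarrow> \<psi> x = 0"
    using smooth_bump[of "r / 2" "c p"] r(1) by auto
  moreover have s: "cball (c p) (r / 2) \<subseteq> ball (c p) r" using r(1) by auto
  moreover have "closed {q \<in> U. c q \<in> cball (c p) (r / 2)}"
    by (rule closed_chart_compact[OF assms(1) compact_cball]) (use r(2) s in blast)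
  ultimately show ?thesis using that r by blast
qed

text \<open>A derivation sees only first-order behaviour. Hadamard's lemma writes
  \<open>f - f p\<close> near \<open>p\<close> as a sum of products of coordinate functions
  vanishing at \<open>p\<close> with smooth factors, and the product rule keeps just the values of
  those factors at \<open>p\<close>, the partial derivatives. Cutoffs enter because derivations act
  on globally defined functions.\<close>

lemma tangent_eq_coord_vec:
  assumes "v \<in> tangent_space A p" "(U, c) \<in> A" "p \<in> U"
  obtains a where "v = coord_vec U c a p"
proof -
  obtain \<psi> :: "'e \<Rightarrow> real" and r where r: "0 < r" "ball (c p) r \<subseteq> c ` U"
    and \<psi>: "smooth_on UNIV \<psi>" "\<psi> (c p) = 1" "\<And>x. x \<notin> cball (c p) (r / 2) \<Longrightarrow> \<psi> x = 0"
    and K: "closed {q \<in> U. c q \<in> cball (c p) (r / 2)}" "cball (c p) (r / 2) \<subseteq> ball (c p) r"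
    by (rule bump_at_chart_point[OF assms(2,3)]) (rule that)
  let ?W = "ball (c p) r"
  define ext where "ext F q = (if q \<in> U \<and> c q \<in> ?W then \<psi> (c q) * F (c q) else 0)" for F q
  have ext: "smooth_fun A (ext F)" if "smooth_on ?W F" for F
    unfolding ext_def
    by (rule smooth_fun_extend_by_zero[OF assms(2) open_ball r(2) smooth_on_mult[OF open_ball smooth_on_subset[OF \<psi>(1)] that] K])
       (use \<psi>(3) in auto)
  have ext_p: "ext F p = F (c p)" for F
    using assms(3) r(1) \<psi>(2) by (simp add: ext_def)
  \<comment> \<open>Cut-off coordinate functions centred at \<open>p\<close>; the components of the
    direction \<open>a\<close> will be the values of \<open>v\<close> on them.\<close>
  define X where "X b = ext (\<lambda>x. (x - c p) \<bullet> b)" for b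
  have X: "smooth_fun A (X b)" "X b p = 0" for b
  proof -
    have "smooth_on ?W (\<lambda>x. (x + - c p) \<bullet> b)"
      by (intro smooth_on_inner smooth_on_add smooth_on_const smooth_on_bounded_linear bounded_linear_ident open_ball)
    then show "smooth_fun A (X b)" unfolding X_def by (intro ext) simp
    show "X b p = 0" by (simp add: X_def ext_p)
  qed
  have "v f = coord_vec U c (\<Sum>b\<in>Basis. v (X b) *\<^sub>R b) p f" for f
  proof (cases "smooth_fun A f")
    case True
    let ?F = "\<lambda>x. f (inv_into U c x)"
    have Fs: "smooth_on ?W ?F" using smooth_on_subset[OF smooth_fun_chart[OF True assms(2)] r(2)] .
    obtain h where h: "\<And>b. smooth_on ?W (h b)" "\<And>b. h b (c p) = frechet_derivative ?F (at (c p)) b"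
      "\<And>x. x \<in> ?W \<Longrightarrow> ?F x = ?F (c p) + (\<Sum>b\<in>Basis. ((x - c p) \<bullet> b) * h b x)"
      using hadamard[OF Fs r(1)] by blast
    have H: "smooth_fun A (ext (h b))" for b using ext[OF h(1)] .
    have P: "smooth_fun A (ext (\<lambda>x. 1))" by (intro ext smooth_on_const open_ball)
    have g: "smooth_fun A (\<lambda>q. f q + - f p)" by (intro smooth_fun_add smooth_fun_const True)
    \<comment> \<open>Both factors of each summand carry a cutoff, so the left side carries its
      square. The identity then holds on the whole manifold, with both sides zero away from the
      ball.\<close>
    have eq: "(\<lambda>q. (ext (\<lambda>x. 1) q * ext (\<lambda>x. 1) q) * (f q + - f p)) = (\<lambda>q. \<Sum>b\<in>Basis. X b q * ext (h b) q)"
    proof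
      fix q
      show "(ext (\<lambda>x. 1) q * ext (\<lambda>x. 1) q) * (f q + - f p) = (\<Sum>b\<in>Basis. X b q * ext (h b) q)"
      proof (cases "q \<in> U \<and> c q \<in> ?W")
        case True
        have "f q + - f p = (\<Sum>b\<in>Basis. ((c q - c p) \<bullet> b) * h b (c q))"
          using h(3)[of "c q"] True chart_inverse(1)[OF assms(2)] assms(3) by simp
        then show ?thesis using True by (simp add: X_def ext_def sum_distrib_left mult_ac)
      next
        case False
        then have "ext F q = 0" for F by (auto simp: ext_def)
        then show ?thesis by simp
      qed
    qed
    \<comment> \<open>At \<open>p\<close> the cutoff equals 1 and \<open>f - f p\<close> vanishes,
      so the product rule returns \<open>v\<close> of the second factor.\<close>
    have "v (\<lambda>q. (ext (\<lambda>x. 1) q * ext (\<lambda>x. 1) q) * (f q + - f p)) = v (\<lambda>q. f q + - f p)"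
      by (simp only: tangent_mult[OF assms(1) smooth_fun_mult[OF P P] g] ext_p) simp
    also have "\<dots> = v f"
      by (simp only: tangent_add[OF assms(1) True smooth_fun_const] tangent_const[OF assms(1)])
    finally have "v f = (\<Sum>b\<in>Basis. v (\<lambda>q. X b q * ext (h b) q))"
      unfolding eq by (simp only: tangent_sum[OF assms(1) smooth_fun_mult[OF X(1) H]])
    also have "\<dots> = (\<Sum>b\<in>Basis. v (X b) * frechet_derivative ?F (at (c p)) b)"
      by (simp only: tangent_mult[OF assms(1) X(1) H] X(2) ext_p h(2)) (simp add: mult.commute)
    also have "\<dots> = frechet_derivative ?F (at (c p)) (\<Sum>b\<in>Basis. v (X b) *\<^sub>R b)"
    proof -
      have lin: "linear (frechet_derivative ?F (at (c p)))"
        using has_derivative_linear[OF smooth_fun_has_derivative[OF True assms(2)]] assms(3) by blast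
      show ?thesis by (simp add: linear_sum[OF lin] linear_cmul[OF lin])
    qed
    finally show ?thesis using True by (simp add: coord_vec_def)
  qed (simp add: coord_vec_def tangent_nonsmooth[OF assms(1)])
  then show ?thesis using that by blast
qed

text \<open>Test the vector on the cut-off linear function whose coordinate gradient at
  \<open>p\<close> is \<open>a\<close> itself; the result is \<open>a \<bullet> a\<close>.\<close>

lemma coord_vec_eq_0D:
  assumes "(U, c) \<in> A" "p \<in> U" "coord_vec U c a p = (\<lambda>f. 0)"
  shows "a = 0"
proof -
  obtain \<psi> :: "'e \<Rightarrow> real" and r where r: "0 < r" "ball (c p) r \<subseteq> c ` U"
    and \<psi>: "smooth_on UNIV \<psi>" "\<psi> (c p) = 1" "\<And>x. x \<notin> cball (c p) (r / 2) \<Longrightarrow> \<psi> x = 0"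
    and K: "closed {q \<in> U. c q \<in> cball (c p) (r / 2)}" "cball (c p) (r / 2) \<subseteq> ball (c p) r"
    by (rule bump_at_chart_point[OF assms(1,2)]) (rule that)
  let ?W = "ball (c p) r" and ?F = "\<lambda>x. \<psi> x * ((x + - c p) \<bullet> a)"
  define f where "f q = (if q \<in> U \<and> c q \<in> ?W then ?F (c q) else 0)" for q
  have "smooth_on ?W ?F"
    by (intro smooth_on_mult smooth_on_subset[OF \<psi>(1)] smooth_on_inner smooth_on_add smooth_on_const
        smooth_on_bounded_linear bounded_linear_ident open_ball subset_UNIV)
  then have f: "smooth_fun A f"
    unfolding f_def by (rule smooth_fun_extend_by_zero[OF assms(1) open_ball r(2) _ K]) (use \<psi>(3) in auto)
  have "((\<lambda>x. ?F x) has_derivative (\<lambda>v. \<psi> (c p) * (v \<bullet> a) + frechet_derivative \<psi> (at (c p)) v * ((c p + - c p) \<bullet> a))) (at (c p))"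
    by (intro has_derivative_mult smooth_on_has_derivative[OF \<psi>(1)]) (auto intro!: derivative_eq_intros)
  then have "((\<lambda>x. ?F x) has_derivative (\<lambda>v. v \<bullet> a)) (at (c p))"
    by (simp add: \<psi>(2))
  then have "((\<lambda>x. f (inv_into U c x)) has_derivative (\<lambda>v. v \<bullet> a)) (at (c p))"
    by (rule has_derivative_transform_within_open[of _ _ _ _ ?W])
       (use r chart_inverse[OF assms(1)] in \<open>auto simp: f_def\<close>)
  then have "coord_vec U c a p f = a \<bullet> a"
    using frechet_derivative_at f by (metis coord_vec_def)
  then show ?thesis using assms(3) by simp
qed

text \<open>For two extensions of the same \<open>v\<close>, torsion-freeness says that the second
  derivatives of \<phi> and the covariant derivatives change by the same amount. Hence the extension
  picked by \<open>SOME\<close> may be replaced by any convenient one.\<close>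

lemma hessian_eq:
  assumes "levi_civita A g D" "smooth_fun A \<phi>" "smooth_vfield A V" "V p = v"
  shows "hessian A D \<phi> p v = v (vf_apply V \<phi>) - D p v V \<phi>"
proof -
  define V' where "V' = (SOME V. smooth_vfield A V \<and> V p = v)"
  have V': "smooth_vfield A V'" "V' p = v"
    unfolding V'_def using someI[of "\<lambda>V. smooth_vfield A V \<and> V p = v" V] assms(3,4) by auto
  have "D p (V p) V' \<phi> - D p (V' p) V \<phi> = V p (vf_apply V' \<phi>) - V' p (vf_apply V \<phi>)"
    using assms(1-3) V'(1) unfolding levi_civita_def by blast
  then show ?thesis
    unfolding hessian_def V'_def[symmetric] Let_def by (simp add: V'(2) assms(4))
qed

text \<open>Justifies the definite description. Through a chart the metric at \<open>p\<close>
  becomes a linear endomorphism of the model space; positivity makes it injective, finite dimension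
  makes it surjective, and a preimage of the coordinate differential of \<open>f\<close> is the
  gradient.\<close>

lemma gradient:
  assumes "riemannian_metric A g" "smooth_fun A f"
  shows "gradient A g f p \<in> tangent_space A p"
    and "u \<in> tangent_space A p \<Longrightarrow> g p (gradient A g f p) u = u f"
proof -
  obtain U c where U: "(U, c) \<in> A" "p \<in> U" using chart_exists .
  let ?T = "tangent_space A p"
  let ?X = "\<lambda>a. coord_vec U c a p"
  have sym: "g p u v = g p v u" if "u \<in> ?T" "v \<in> ?T" for u v
    using assms(1) that unfolding riemannian_metric_def by blast
  have lin1: "g p (lincomb k u l v) w = k * g p u w + l * g p v w" if "u \<in> ?T" "v \<in> ?T" "w \<in> ?T" for k l u v w
    using assms(1) that unfolding riemannian_metric_def by blast
  have pos: "0 < g p v v" if "v \<in> ?T" "v \<noteq> (\<lambda>f. 0)" for v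
    using assms(1) that unfolding riemannian_metric_def by blast
  have lin2: "g p w (lincomb k u l v) = k * g p w u + l * g p w v" if "u \<in> ?T" "v \<in> ?T" "w \<in> ?T" for k l u v w
    using that lincomb_tangent by (simp add: sym[of w] lin1)
  have X: "?X a \<in> ?T" for a using coord_vec_tangent[OF U] .
  have Xl: "?X (k *\<^sub>R a + l *\<^sub>R b) = lincomb k (?X a) l (?X b)" for k l a b
    using coord_vec_lincomb[OF U] .
  \<comment> \<open>The Gram matrix of the coordinate vectors, acting on the model space.\<close>
  let ?L = "\<lambda>a. \<Sum>b\<in>Basis. g p (?X a) (?X b) *\<^sub>R b"
  have "\<exists>w\<in>?T. \<forall>u\<in>?T. g p w u = u f"
  proof -
    have lin: "linear ?L"
    proof
      show "?L (a + b) = ?L a + ?L b" for a b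
        using Xl[of 1 a 1 b] lin1[OF X X X] by (simp add: scaleR_add_left sum.distrib)
      show "?L (k *\<^sub>R a) = k *\<^sub>R ?L a" for k a
        using Xl[of k a 0 0] lin1[OF X X X] by (simp add: scaleR_sum_right)
    qed
    have inner: "?L a \<bullet> b = g p (?X a) (?X b)" for a b
    proof -
      have l: "linear (\<lambda>b. g p (?X a) (?X b))"
      proof
        show "g p (?X a) (?X (b + d)) = g p (?X a) (?X b) + g p (?X a) (?X d)" for b d
          using Xl[of 1 b 1 d] lin2[OF X X X] by simp
        show "g p (?X a) (?X (k *\<^sub>R b)) = k *\<^sub>R g p (?X a) (?X b)" for k b
          using Xl[of k b 0 0] lin2[OF X X X] by simp
      qed
      have "?L a \<bullet> b = (\<Sum>d\<in>Basis. g p (?X a) (?X d) * (b \<bullet> d))"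
        by (simp add: inner_sum_left inner_commute[of b])
      also have "\<dots> = g p (?X a) (?X b)"
        using linear_sum[OF l, of "\<lambda>d. (b \<bullet> d) *\<^sub>R d" Basis]
        by (simp only: euclidean_representation linear_cmul[OF l] real_scaleR_def mult.commute)
      finally show ?thesis .
    qed
    have "inj ?L"
    proof (rule linear_injective_0[OF lin, THEN iffD2], intro allI impI)
      fix a assume "?L a = 0"
      then have "g p (?X a) (?X a) = 0" using inner[of a a] by simp
      then have "?X a = (\<lambda>f. 0)" using pos[OF X[of a]] by fastforce
      then show "a = 0" by (rule coord_vec_eq_0D[OF U])
    qed
    then have "surj ?L" using linear_injective_imp_surjective[OF lin] by blast
    then obtain a where a: "(\<Sum>b\<in>Basis. ?X b f *\<^sub>R b) = ?L a" using surjD[of ?L] by blast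
    have "g p (?X a) u = u f" if u: "u \<in> ?T" for u
    proof -
      obtain d where d: "u = ?X d" using tangent_eq_coord_vec[OF u U] .
      have l: "linear (\<lambda>b. ?X b f)"
      proof
        show "?X (b + d) f = ?X b f + ?X d f" for b d using Xl[of 1 b 1 d] by (simp add: lincomb_def)
        show "?X (k *\<^sub>R b) f = k *\<^sub>R ?X b f" for k b using Xl[of k b 0 0] by (simp add: lincomb_def)
      qed
      have "g p (?X a) (?X d) = (\<Sum>b\<in>Basis. ?X b f *\<^sub>R b) \<bullet> d" using inner[of a d] a by simp
      also have "\<dots> = (\<Sum>b\<in>Basis. (d \<bullet> b) * ?X b f)"
        by (simp add: inner_sum_left inner_commute[of d] mult.commute[of "?X _ f"])
      also have "\<dots> = ?X d f"
        using linear_sum[OF l, of "\<lambda>b. (d \<bullet> b) *\<^sub>R b" Basis]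
        by (simp only: euclidean_representation linear_cmul[OF l] real_scaleR_def)
      finally show ?thesis using d by simp
    qed
    then show ?thesis using X by blast
  qed
  moreover have "w = w'" if w: "w \<in> ?T" "\<forall>u\<in>?T. g p w u = u f" and w': "w' \<in> ?T" "\<forall>u\<in>?T. g p w' u = u f" for w w'
  proof -
    have T: "lincomb 1 w (-1) w' \<in> ?T" using w w' by (intro lincomb_tangent)
    have "g p (lincomb 1 w (-1) w') (lincomb 1 w (-1) w') = 0"
      using T w w' lin1[OF w(1) w'(1) T, of 1 "-1"] by simp
    then have "lincomb 1 w (-1) w' = (\<lambda>f. 0)" using pos[OF T] by fastforce
    then show "w = w'" by (simp add: lincomb_def fun_eq_iff)
  qed
  ultimately have "\<exists>!w. w \<in> ?T \<and> (\<forall>u\<in>?T. g p w u = u f)" by blast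
  from theI'[OF this]
  show "gradient A g f p \<in> tangent_space A p"
    and "u \<in> tangent_space A p \<Longrightarrow> g p (gradient A g f p) u = u f"
    unfolding gradient_def by blast+
qed

end

section \<open>The product manifold\<close>

abbreviation product_chart :: "('m \<Rightarrow> 'e) \<Rightarrow> real \<times> 'm \<Rightarrow> real \<times> 'e" where
  "product_chart c \<equiv> \<lambda>(t, x). (t, c x)"

context smooth_manifold
begin

lemma product_atlas_iff:
  "(U', c') \<in> product_atlas A \<longleftrightarrow> (\<exists>U c. (U, c) \<in> A \<and> U' = UNIV \<times> U \<and> c' = product_chart c)"
  unfolding product_atlas_def by force

lemma product_chart_image: "product_chart c ` (UNIV \<times> U) = UNIV \<times> c ` U"
  by force

lemma inv_into_product_chart:
  assumes "(U, c) \<in> A" "e \<in> c ` U"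
  shows "inv_into (UNIV \<times> U) (product_chart c) (t, e) = (t, inv_into U c e)"
proof (rule inv_into_f_eq)
  show "inj_on (product_chart c) (UNIV \<times> U)"
    using chart_inverse(4)[OF assms(1)] by (auto simp: inj_on_def)
  show "(t, inv_into U c e) \<in> UNIV \<times> U" "product_chart c (t, inv_into U c e) = (t, e)"
    using chart_inverse[OF assms(1)] assms(2) by auto
qed

lemma smooth_manifold_product: "smooth_manifold (product_atlas A)"
proof
  have chart: "is_chart (UNIV \<times> U, product_chart c)" if U: "(U, c) \<in> A" for U c
  proof -
    note h = chart_homeomorphism[OF U]
    have "continuous_on (UNIV \<times> U) (\<lambda>z. (fst z, c (snd z)))"
      by (intro continuous_on_Pair continuous_on_fst continuous_on_id
          continuous_on_compose2[OF homeomorphism_cont1[OF h(3)] continuous_on_snd[OF continuous_on_id]]) auto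
    then have c1: "continuous_on (UNIV \<times> U) (product_chart c)" by (simp add: case_prod_beta')
    have "continuous_on (UNIV \<times> c ` U) (\<lambda>z. (fst z, inv_into U c (snd z)))"
      by (intro continuous_on_Pair continuous_on_fst continuous_on_id
          continuous_on_compose2[OF homeomorphism_cont2[OF h(3)] continuous_on_snd[OF continuous_on_id]]) auto
    then have c2: "continuous_on (UNIV \<times> c ` U) (inv_into (UNIV \<times> U) (product_chart c))"
      by (rule continuous_on_eq) (use inv_into_product_chart[OF U] in auto)
    have "homeomorphism (UNIV \<times> U) (product_chart c ` (UNIV \<times> U)) (product_chart c) (inv_into (UNIV \<times> U) (product_chart c))"
      unfolding product_chart_image
      by (rule homeomorphismI[OF c1 c2])
         (use inv_into_product_chart[OF U] chart_inverse[OF U] in auto)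
    then show ?thesis
      using h(1,2) by (simp add: is_chart_def product_chart_image open_Times)
  qed
  have compat: "compatible (UNIV \<times> U, product_chart c) (UNIV \<times> V, product_chart d)"
    if U: "(U, c) \<in> A" and V: "(V, d) \<in> A" for U c V d
  proof -
    let ?S = "UNIV \<times> c ` (U \<inter> V) :: (real \<times> 'e) set"
    have o: "open (c ` (U \<inter> V))"
      using chart_open_image[OF U] chart_homeomorphism(1)[OF U] chart_homeomorphism(1)[OF V] by auto
    have S: "open ?S" using o by (intro open_Times) auto
    have "smooth_on ?S (\<lambda>z. (fst z, d (inv_into U c (snd z))))"
      by (intro smooth_on_Pair S smooth_on_compose[OF S o _ _ transition_smooth[OF U V]]
          smooth_on_bounded_linear bounded_linear_fst bounded_linear_snd) auto
    then have "smooth_on ?S (product_chart d \<circ> inv_into (UNIV \<times> U) (product_chart c))"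
      by (rule smooth_on_cong[OF S, rotated]) (use inv_into_product_chart[OF U] in auto)
    moreover have "product_chart c ` (UNIV \<times> U \<inter> UNIV \<times> V) = ?S" by force
    ultimately show ?thesis by (simp add: compatible_def)
  qed
  have cover: "\<Union>(fst ` product_atlas A) = UNIV"
  proof -
    have "z \<in> \<Union>(fst ` product_atlas A)" for z :: "real \<times> 'm"
    proof -
      obtain U c where "(U, c) \<in> A" "snd z \<in> U" using chart_exists .
      then have "(UNIV \<times> U, product_chart c) \<in> product_atlas A" "z \<in> UNIV \<times> U"
        using product_atlas_iff by (blast, simp add: mem_Times_iff)
      then show ?thesis by force
    qed
    then show ?thesis by blast
  qed
  have "\<forall>C\<in>product_atlas A. is_chart C" "\<forall>C\<in>product_atlas A. \<forall>D\<in>product_atlas A. compatible C D"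
    using chart compat unfolding product_atlas_def by auto
  with cover show "smooth_atlas (product_atlas A)"
    unfolding smooth_atlas_def by blast
qed

section \<open>Smooth functions and tangent vectors on the product\<close>

lemma smooth_fun_product_iff:
  "smooth_fun (product_atlas A) f \<longleftrightarrow>
     (\<forall>(U, c)\<in>A. smooth_on (UNIV \<times> c ` U) (\<lambda>z. f (fst z, inv_into U c (snd z))))"
proof -
  have "smooth_on (product_chart c ` (UNIV \<times> U)) (f \<circ> inv_into (UNIV \<times> U) (product_chart c)) \<longleftrightarrow>
      smooth_on (UNIV \<times> c ` U) (\<lambda>z. f (fst z, inv_into U c (snd z)))" if U: "(U, c) \<in> A" for U c
  proof -
    have o: "open (UNIV \<times> c ` U :: (real \<times> 'e) set)" using chart_homeomorphism(2)[OF U] by (intro open_Times) auto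
    have "(f \<circ> inv_into (UNIV \<times> U) (product_chart c)) z = f (fst z, inv_into U c (snd z))" if "z \<in> UNIV \<times> c ` U" for z
      using that inv_into_product_chart[OF U, of "snd z" "fst z"] by (simp add: mem_Times_iff)
    then show ?thesis unfolding product_chart_image using smooth_on_cong[OF o] by (smt (verit, best))
  qed
  then show ?thesis
    unfolding smooth_fun_def product_atlas_def by (auto simp: split_beta)
qed

lemma smooth_fun_snd:
  assumes "smooth_fun A h"
  shows "smooth_fun (product_atlas A) (\<lambda>z. h (snd z))"
  unfolding smooth_fun_product_iff
proof safe
  fix U c assume U: "(U, c) \<in> A"
  note o = chart_homeomorphism(2)[OF U]
  show "smooth_on (UNIV \<times> c ` U) (\<lambda>z. h (snd (fst z, inv_into U c (snd z))))"
    unfolding snd_conv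
    by (rule smooth_on_compose[OF open_Times[OF open_UNIV o] o _
          smooth_on_bounded_linear[OF bounded_linear_snd open_Times[OF open_UNIV o]] smooth_fun_chart[OF assms U]]) auto
qed

lemma smooth_fun_fst: "smooth_fun (product_atlas A) fst"
  unfolding smooth_fun_product_iff
  using chart_homeomorphism(2) by (auto intro!: smooth_on_bounded_linear bounded_linear_fst open_Times)

context
  fixes f :: "real \<times> 'm \<Rightarrow> real" and U c
  assumes f: "smooth_fun (product_atlas A) f" and U: "(U, c) \<in> A"
begin

abbreviation "loc \<equiv> \<lambda>z. f (fst z, inv_into U c (snd z))"

lemma smooth_on_loc: "smooth_on (UNIV \<times> c ` U) loc"
  using f U unfolding smooth_fun_product_iff by blast

lemma loc_has_derivative:
  "e \<in> c ` U \<Longrightarrow> (loc has_derivative frechet_derivative loc (at (s, e))) (at (s, e))"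
  by (rule smooth_on_has_derivative[OF smooth_on_loc]) auto

lemma time_derivative:
  assumes "e \<in> c ` U"
  shows "((\<lambda>s. f (s, inv_into U c e)) has_real_derivative frechet_derivative loc (at (s, e)) (1, 0)) (at s)"
proof -
  have lin: "linear (frechet_derivative loc (at (s, e)))"
    using has_derivative_linear[OF loc_has_derivative[OF assms]] .
  have "((\<lambda>s. loc (s, e)) has_derivative (\<lambda>k. frechet_derivative loc (at (s, e)) (k, 0))) (at s)"
    by (rule has_derivative_compose[of "\<lambda>s. (s, e)", OF _ loc_has_derivative[OF assms]])
       (auto intro!: derivative_eq_intros)
  moreover have "(\<lambda>k. frechet_derivative loc (at (s, e)) (k, 0)) = (*) (frechet_derivative loc (at (s, e)) (1, 0))"
  proof
    show "frechet_derivative loc (at (s, e)) (k, 0) = frechet_derivative loc (at (s, e)) (1, 0) * k" for k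
      using linear_cmul[OF lin, of k "(1, 0)"] by simp
  qed
  ultimately show ?thesis unfolding has_field_derivative_def by (simp only: fst_conv snd_conv)
qed

text \<open>Freezing the time variable does not change the derivative in space directions. Rewriting
  it through \<open>loc\<close> shows that it is smooth in time and space jointly.\<close>

lemma space_derivative:
  assumes "e \<in> c ` U"
  shows "frechet_derivative (\<lambda>x. f (s, inv_into U c x)) (at e) a = frechet_derivative loc (at (s, e)) (0, a)"
proof -
  have "((\<lambda>x. loc (s, x)) has_derivative (\<lambda>a. frechet_derivative loc (at (s, e)) (0, a))) (at e)"
    by (rule has_derivative_compose[of "\<lambda>x. (s, x)", OF _ loc_has_derivative[OF assms]])
       (auto intro!: derivative_eq_intros)
  then show ?thesis using fun_cong[OF frechet_derivative_at] by fastforce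
qed

end

lemma smooth_fun_slice:
  assumes "smooth_fun (product_atlas A) f"
  shows "smooth_fun A (\<lambda>y. f (s, y))"
  unfolding smooth_fun_def
proof safe
  fix U c assume U: "(U, c) \<in> A"
  note o = chart_homeomorphism(2)[OF U]
  have "smooth_on (c ` U) (\<lambda>e. (\<lambda>z. f (fst z, inv_into U c (snd z))) (s, e))"
    by (intro smooth_on_compose[OF o open_Times[OF open_UNIV o] _ _ smooth_on_loc[OF assms U]]
        smooth_on_Pair smooth_on_const smooth_on_bounded_linear bounded_linear_ident o) auto
  then show "smooth_on (c ` U) ((\<lambda>y. f (s, y)) \<circ> inv_into U c)" by (simp add: o_def)
qed

lemma time_differentiable:
  assumes "smooth_fun (product_atlas A) f"
  shows "((\<lambda>s. f (s, y)) has_real_derivative deriv (\<lambda>s. f (s, y)) s) (at s)"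
proof -
  obtain U c where U: "(U, c) \<in> A" "y \<in> U" using chart_exists .
  have "((\<lambda>s. f (s, y)) has_real_derivative frechet_derivative (\<lambda>z. f (fst z, inv_into U c (snd z))) (at (s, c y)) (1, 0)) (at s)"
    using time_derivative[OF assms U(1), of "c y" s] chart_inverse(1)[OF U] U(2) by simp
  from DERIV_imp_deriv[OF this] this show ?thesis by (simp only:)
qed

lemma smooth_fun_deriv_time:
  assumes "smooth_fun (product_atlas A) f"
  shows "smooth_fun (product_atlas A) (\<lambda>z. deriv (\<lambda>s. f (s, snd z)) (fst z))"
  unfolding smooth_fun_product_iff
proof safe
  fix U c assume U: "(U, c) \<in> A"
  have o: "open (UNIV \<times> c ` U :: (real \<times> 'e) set)" using chart_homeomorphism(2)[OF U] by (intro open_Times) auto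
  show "smooth_on (UNIV \<times> c ` U) (\<lambda>z. deriv (\<lambda>s. f (s, snd (fst z, inv_into U c (snd z)))) (fst (fst z, inv_into U c (snd z))))"
    by (rule smooth_on_cong[OF o _ smooth_on_frechet_derivative[OF smooth_on_loc[OF assms U], of "(1, 0)"]])
       (use DERIV_imp_deriv[OF time_derivative[OF assms U]] in auto)
qed

lemma product_vec_tangent:
  assumes "v \<in> tangent_space A x"
  shows "product_vec A t x \<tau> v \<in> tangent_space (product_atlas A) (t, x)"
proof -
  interpret P: smooth_manifold "product_atlas A" by (rule smooth_manifold_product)
  note d = time_differentiable[of _ x t]
  have "product_vec A t x \<tau> v (\<lambda>q. a * f q + b * g q) = a * product_vec A t x \<tau> v f + b * product_vec A t x \<tau> v g"
    if f: "smooth_fun (product_atlas A) f" and g: "smooth_fun (product_atlas A) g" for f g a b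
    using DERIV_imp_deriv[OF DERIV_add[OF DERIV_cmult[OF d[OF f], of a] DERIV_cmult[OF d[OF g], of b]]]
      tangent_lincomb[OF assms smooth_fun_slice[OF f] smooth_fun_slice[OF g]] f g
      P.smooth_fun_add[OF P.smooth_fun_mult[OF P.smooth_fun_const f] P.smooth_fun_mult[OF P.smooth_fun_const g]]
    by (simp add: product_vec_def algebra_simps)
  moreover have "product_vec A t x \<tau> v (\<lambda>q. f q * g q) = f (t, x) * product_vec A t x \<tau> v g + g (t, x) * product_vec A t x \<tau> v f"
    if f: "smooth_fun (product_atlas A) f" and g: "smooth_fun (product_atlas A) g" for f g
    using DERIV_imp_deriv[OF DERIV_mult[OF d[OF f] d[OF g]]]
      tangent_mult[OF assms smooth_fun_slice[OF f] smooth_fun_slice[OF g]] f g P.smooth_fun_mult[OF f g]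
    by (simp add: product_vec_def algebra_simps)
  ultimately show ?thesis
    unfolding tangent_space_def by (auto simp: product_vec_def)
qed

text \<open>Lifting an arbitrary smooth vector field to the product would need Hadamard's lemma with
  parameters; the fields below have explicit coordinates, which makes smoothness of the lift
  immediate, and they already realise every tangent vector.\<close>

lemma tangent_extension:
  assumes "v \<in> tangent_space A x"
  obtains V where "smooth_vfield A V" "V x = v"
    "\<And>\<tau>. smooth_vfield (product_atlas A) (\<lambda>z. product_vec A (fst z) (snd z) \<tau> (V (snd z)))"
proof -
  interpret P: smooth_manifold "product_atlas A" by (rule smooth_manifold_product)
  obtain U c where U: "(U, c) \<in> A" "x \<in> U" using chart_exists .
  obtain a where a: "v = coord_vec U c a x" using tangent_eq_coord_vec[OF assms U] .
  obtain \<psi> :: "'e \<Rightarrow> real" and r where r: "0 < r" "ball (c x) r \<subseteq> c ` U"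
    and \<psi>: "smooth_on UNIV \<psi>" "\<psi> (c x) = 1" "\<And>e. e \<notin> cball (c x) (r / 2) \<Longrightarrow> \<psi> e = 0"
    and K: "closed {q \<in> U. c q \<in> cball (c x) (r / 2)}" "cball (c x) (r / 2) \<subseteq> ball (c x) r"
    by (rule bump_at_chart_point[OF U]) (rule that)
  let ?K = "cball (c x) (r / 2)"
  have KU: "?K \<subseteq> c ` U" using K(2) r(2) by blast
  note o = chart_homeomorphism(2)[OF U(1)]
  \<comment> \<open>The coordinate field with constant components, multiplied by the bump. The case
    distinction has the shape required by \<open>smooth_fun_extend_by_zero\<close>, with the whole
    chart image as \<open>W\<close>.\<close>
  define V where "V q f = (if q \<in> U \<and> c q \<in> c ` U then \<psi> (c q) * coord_vec U c a q f else 0)" for q f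
  have tangent: "V q \<in> tangent_space A q" for q
  proof (cases "q \<in> U")
    case True
    then have "V q = lincomb (\<psi> (c q)) (coord_vec U c a q) 0 (coord_vec U c a q)"
      by (auto simp: V_def lincomb_def)
    then show ?thesis using lincomb_tangent[OF coord_vec_tangent[OF U(1) True] coord_vec_tangent[OF U(1) True]] by metis
  next
    case False
    then show ?thesis by (simp add: V_def tangent_space_def)
  qed
  have "smooth_fun A (vf_apply V f)" if f: "smooth_fun A f" for f
  proof -
    have "smooth_on (c ` U) (\<lambda>e. \<psi> e * frechet_derivative (\<lambda>y. f (inv_into U c y)) (at e) a)"
      by (intro smooth_on_mult o smooth_on_subset[OF \<psi>(1)] smooth_on_frechet_derivative smooth_fun_chart[OF f U(1)] subset_UNIV)
    then show ?thesis
      unfolding vf_apply_def V_def coord_vec_def if_P[OF f]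
      by (rule smooth_fun_extend_by_zero[OF U(1) o subset_refl _ K(1) KU]) (use \<psi>(3) in auto)
  qed
  then have smooth: "smooth_vfield A V" using tangent by (simp add: smooth_vfield_def)
  have x: "V x = v" using U(2) \<psi>(2) by (simp add: V_def fun_eq_iff a)
  have "smooth_vfield (product_atlas A) (\<lambda>z. product_vec A (fst z) (snd z) \<tau> (V (snd z)))" for \<tau>
  proof -
    let ?V = "\<lambda>z. product_vec A (fst z) (snd z) \<tau> (V (snd z))"
    have "smooth_fun (product_atlas A) (vf_apply ?V f)" if f: "smooth_fun (product_atlas A) f" for f
    proof -
      let ?U = "UNIV \<times> U :: (real \<times> 'm) set" and ?c = "product_chart c"
      let ?loc = "\<lambda>z. f (fst z, inv_into U c (snd z))"
      let ?G = "\<lambda>z. \<psi> (snd z) * frechet_derivative ?loc (at z) (0, a)"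
      have oW: "open (UNIV \<times> c ` U :: (real \<times> 'e) set)" using o by (intro open_Times) auto
      have PU: "(?U, ?c) \<in> product_atlas A" using U(1) product_atlas_iff by blast
      have G: "smooth_on (UNIV \<times> c ` U) ?G"
        by (intro smooth_on_mult oW smooth_on_compose[OF oW open_UNIV _ _ \<psi>(1)]
            smooth_on_bounded_linear bounded_linear_snd smooth_on_frechet_derivative smooth_on_loc[OF f U(1)]) auto
      \<comment> \<open>The cutoff is independent of time, so its support in the product is
        unbounded and not compact; closedness is obtained from the product structure
        instead.\<close>
      have "{q \<in> ?U. ?c q \<in> UNIV \<times> ?K} = UNIV \<times> {q \<in> U. c q \<in> ?K}" by auto
      then have cl: "closed {q \<in> ?U. ?c q \<in> UNIV \<times> ?K}" using K(1) by (simp only: closed_Times closed_UNIV)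
      have "smooth_fun (product_atlas A) (\<lambda>q. if q \<in> ?U \<and> ?c q \<in> UNIV \<times> c ` U then ?G (?c q) else 0)"
      proof (rule P.smooth_fun_extend_by_zero[OF PU oW _ G cl])
        show "?G z = 0" if "z \<in> UNIV \<times> c ` U - UNIV \<times> ?K" for z
          using that \<psi>(3)[of "snd z"] by (auto simp: mem_Times_iff)
      qed (use KU product_chart_image in auto)
      also have "(\<lambda>q. if q \<in> ?U \<and> ?c q \<in> UNIV \<times> c ` U then ?G (?c q) else 0) = (\<lambda>q. V (snd q) (\<lambda>y. f (fst q, y)))"
        using space_derivative[OF f U(1)] smooth_fun_slice[OF f]
        by (auto simp: fun_eq_iff V_def coord_vec_def)
      finally have "smooth_fun (product_atlas A) (\<lambda>q. V (snd q) (\<lambda>y. f (fst q, y)))" .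
      then have "smooth_fun (product_atlas A) (\<lambda>z. \<tau> * deriv (\<lambda>s. f (s, snd z)) (fst z) + V (snd z) (\<lambda>y. f (fst z, y)))"
        by (intro P.smooth_fun_add P.smooth_fun_mult P.smooth_fun_const smooth_fun_deriv_time f)
      then show ?thesis using f by (simp add: vf_apply_def product_vec_def)
    qed
    moreover have "?V z \<in> tangent_space (product_atlas A) z" for z
      using product_vec_tangent[OF tangent[of "snd z"], of "fst z" \<tau>] by simp
    ultimately show ?thesis unfolding smooth_vfield_def by blast
  qed
  then show ?thesis using that smooth x by blast
qed

end

section \<open>The Hessian\<close>

context smooth_manifold
begin

section \<open>Components of product vectors\<close>

lemma product_vec_snd:
  assumes "smooth_fun A h"
  shows "product_vec A t x \<tau> v (\<lambda>z. h (snd z)) = v h"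
  using smooth_fun_snd[OF assms] by (simp add: product_vec_def)

lemma time_comp_product_vec:
  assumes "v \<in> tangent_space A x"
  shows "time_comp (product_vec A t x \<tau> v) = \<tau>"
  using smooth_fun_fst tangent_const[OF assms, of t] by (simp add: time_comp_def product_vec_def)

lemma space_comp_product_vec:
  assumes "v \<in> tangent_space A x"
  shows "space_comp A (product_vec A t x \<tau> v) = v"
  using product_vec_snd tangent_nonsmooth[OF assms] by (auto simp: space_comp_def fun_eq_iff o_def)

lemma space_comp_tangent:
  assumes "u \<in> tangent_space (product_atlas A) (t, x)"
  shows "space_comp A u \<in> tangent_space A x"
proof -
  interpret P: smooth_manifold "product_atlas A" by (rule smooth_manifold_product)
  have "space_comp A u (\<lambda>q. a * f q + b * g q) = a * space_comp A u f + b * space_comp A u g"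
    if f: "smooth_fun A f" and g: "smooth_fun A g" for f g a b
    using P.tangent_lincomb[OF assms smooth_fun_snd[OF f] smooth_fun_snd[OF g]] f g
      smooth_fun_add[OF smooth_fun_mult[OF smooth_fun_const f] smooth_fun_mult[OF smooth_fun_const g]]
    by (simp add: space_comp_def o_def)
  moreover have "space_comp A u (\<lambda>q. f q * g q) = f x * space_comp A u g + g x * space_comp A u f"
    if f: "smooth_fun A f" and g: "smooth_fun A g" for f g
    using P.tangent_mult[OF assms smooth_fun_snd[OF f] smooth_fun_snd[OF g]] f g smooth_fun_mult[OF f g]
    by (simp add: space_comp_def o_def)
  ultimately show ?thesis
    unfolding tangent_space_def by (auto simp: space_comp_def)
qed

section \<open>The axioms of metric and connection in directly applicable form\<close>

lemma riemannian_metric_sym: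
  "riemannian_metric A g \<Longrightarrow> u \<in> tangent_space A p \<Longrightarrow> v \<in> tangent_space A p \<Longrightarrow> g p u v = g p v u"
  unfolding riemannian_metric_def by blast

lemma riemannian_metric_lincomb:
  assumes "riemannian_metric A g" "u \<in> tangent_space A p" "v \<in> tangent_space A p" "w \<in> tangent_space A p"
  shows "g p (lincomb a u b v) w = a * g p u w + b * g p v w"
    and "g p w (lincomb a u b v) = a * g p w u + b * g p w v"
proof -
  show 1: "g p (lincomb a u b v) w = a * g p u w + b * g p v w"
    using assms unfolding riemannian_metric_def by blast
  show "g p w (lincomb a u b v) = a * g p w u + b * g p w v"
    using 1 riemannian_metric_sym[OF assms(1,4)] lincomb_tangent assms(2,3) by metis
qed

lemma riemannian_metric_smooth:
  "riemannian_metric A g \<Longrightarrow> smooth_vfield A X \<Longrightarrow> smooth_vfield A Y \<Longrightarrow> smooth_fun A (\<lambda>p. g p (X p) (Y p))"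
  unfolding riemannian_metric_def by blast

lemma levi_civita_tangent:
  assumes "levi_civita A g D" "smooth_vfield A Y" "v \<in> tangent_space A p"
  shows "D p v Y \<in> tangent_space A p"
proof -
  have "\<forall>p Y. smooth_vfield A Y \<longrightarrow> (\<forall>v\<in>tangent_space A p. D p v Y \<in> tangent_space A p)"
    using assms(1) unfolding levi_civita_def affine_connection_def by (elim conjE)
  then show ?thesis using assms(2,3) by blast
qed

lemma levi_civita_lincomb:
  assumes "levi_civita A g D" "smooth_vfield A Y" "u \<in> tangent_space A p" "v \<in> tangent_space A p"
  shows "D p (lincomb a u b v) Y = lincomb a (D p u Y) b (D p v Y)"
proof -
  have "\<forall>p Y a b. smooth_vfield A Y \<longrightarrow> (\<forall>u\<in>tangent_space A p. \<forall>v\<in>tangent_space A p.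
      D p (lincomb a u b v) Y = lincomb a (D p u Y) b (D p v Y))"
    using assms(1) unfolding levi_civita_def affine_connection_def by (elim conjE)
  then show ?thesis using assms(2-4) by blast
qed

lemma levi_civita_metric:
  "levi_civita A g D \<Longrightarrow> smooth_vfield A Y \<Longrightarrow> smooth_vfield A Z \<Longrightarrow> v \<in> tangent_space A p \<Longrightarrow>
    v (\<lambda>q. g q (Y q) (Z q)) = g p (D p v Y) (Z p) + g p (Y p) (D p v Z)"
  unfolding levi_civita_def by blast

lemma levi_civita_torsion:
  "levi_civita A g D \<Longrightarrow> smooth_vfield A X \<Longrightarrow> smooth_vfield A Y \<Longrightarrow> smooth_fun A f \<Longrightarrow>
    D p (X p) Y f - D p (Y p) X f = X p (vf_apply Y f) - Y p (vf_apply X f)"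
  unfolding levi_civita_def by blast

end

text \<open>The scalar \<sigma> is the time component of the gradient of \<phi>. It is characterised
  here by its linear equation, which keeps the computation polynomial and free of division.\<close>

lemma hessian_stationary:
  fixes A :: "('m::{t2_space, second_countable_topology}, 'e::euclidean_space) chart set"
    and gR :: "'m metric_field" and \<delta> :: "'m vfield"
  assumes "smooth_atlas A"
    and gR: "riemannian_metric A gR"
    and \<beta>: "smooth_fun A \<beta>"
    and \<delta>: "smooth_vfield A \<delta>"
    and LCR: "levi_civita A gR DR"
    and LC: "levi_civita (product_atlas A) (stationary_metric A gR \<beta> \<delta>) D"
    and \<phi>: "smooth_fun (product_atlas A) (\<lambda>z. \<phi>\<^sub>0 (snd z))"
    and v: "v \<in> tangent_space A x"
    and \<sigma>: "\<sigma> * (\<beta> x + gR x (\<delta> x) (\<delta> x)) = \<delta> x \<phi>\<^sub>0"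
  shows "hessian (product_atlas A) D (\<lambda>z. \<phi>\<^sub>0 (snd z)) (t, x) (product_vec A t x \<tau> v) =
    hessian A DR \<phi>\<^sub>0 x v
    + \<sigma> * (\<tau> * v \<beta> + 1 / 2 * \<tau>\<^sup>2 * \<delta> x \<beta> - sym_cov gR DR \<delta> x v v
            + \<tau> * rot gR DR \<delta> x v (\<delta> x))
    + \<tau> * rot gR DR \<delta> x (gradient A gR \<phi>\<^sub>0 x) v
    - 1 / 2 * \<tau>\<^sup>2 * gradient A gR \<beta> x \<phi>\<^sub>0"
proof -
  interpret M: smooth_manifold A by (rule smooth_manifold.intro) fact
  interpret P: smooth_manifold "product_atlas A" by (rule M.smooth_manifold_product)
  let ?p = "(t, x)" and ?G = "stationary_metric A gR \<beta> \<delta>"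
  have \<phi>\<^sub>0: "smooth_fun A \<phi>\<^sub>0" using M.smooth_fun_slice[OF \<phi>] by simp
  have \<delta>T: "\<delta> q \<in> tangent_space A q" for q using \<delta> unfolding smooth_vfield_def by blast
  note sym = M.riemannian_metric_sym[OF gR] and lin = M.riemannian_metric_lincomb[OF gR]
  define n where "n = gradient A gR \<phi>\<^sub>0 x"
  have n: "n \<in> tangent_space A x" "\<And>u. u \<in> tangent_space A x \<Longrightarrow> gR x n u = u \<phi>\<^sub>0"
    unfolding n_def using M.gradient[OF gR \<phi>\<^sub>0] by blast+
  define w where "w = lincomb 1 n (- \<sigma>) (\<delta> x)"
  have w: "w \<in> tangent_space A x" unfolding w_def by (rule M.lincomb_tangent[OF n(1) \<delta>T])
  obtain V where V: "smooth_vfield A V" "V x = v"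
    and VP: "\<And>\<tau>. smooth_vfield (product_atlas A) (\<lambda>z. product_vec A (fst z) (snd z) \<tau> (V (snd z)))"
    by (rule M.tangent_extension[OF v]) (rule that)
  obtain W where W: "smooth_vfield A W" "W x = w"
    and WP: "\<And>\<tau>. smooth_vfield (product_atlas A) (\<lambda>z. product_vec A (fst z) (snd z) \<tau> (W (snd z)))"
    by (rule M.tangent_extension[OF w]) (rule that)
  have VT: "V q \<in> tangent_space A q" and WT: "W q \<in> tangent_space A q" for q
    using V(1) W(1) unfolding smooth_vfield_def by blast+
  define V' where "V' z = product_vec A (fst z) (snd z) \<tau> (V (snd z))" for z
  define W' where "W' z = product_vec A (fst z) (snd z) \<sigma> (W (snd z))" for z
  have V': "smooth_vfield (product_atlas A) V'" and W': "smooth_vfield (product_atlas A) W'"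
    using VP[of \<tau>] WP[of \<sigma>] by (simp_all add: V'_def[abs_def] W'_def[abs_def])
  have V'T: "V' q \<in> tangent_space (product_atlas A) q" and W'T: "W' q \<in> tangent_space (product_atlas A) q" for q
    using V' W' unfolding smooth_vfield_def by blast+
  have V'p: "V' ?p = product_vec A t x \<tau> v" by (simp add: V'_def V(2))
  \<comment> \<open>On functions of the space variable the lifts act as the original fields, which
    moves every derivative in the Koszul formula to the space factor.\<close>
  have V'snd: "V' q (\<lambda>z. h (snd z)) = V (snd q) h" and W'snd: "W' q (\<lambda>z. h (snd z)) = W (snd q) h"
    if "smooth_fun A h" for q h
    unfolding V'_def W'_def by (rule M.product_vec_snd[OF that])+
  have vfV: "vf_apply V' (\<lambda>z. h (snd z)) = (\<lambda>z. vf_apply V h (snd z))"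
    and vfW: "vf_apply W' (\<lambda>z. h (snd z)) = (\<lambda>z. vf_apply W h (snd z))" if "smooth_fun A h" for h
    using V'snd[OF that] W'snd[OF that] by (simp_all add: vf_apply_def)
  have sm: "smooth_fun A (vf_apply V h)" "smooth_fun A (vf_apply W h)" if "smooth_fun A h" for h
    using V(1) W(1) that unfolding smooth_vfield_def by blast+
  have compV: "time_comp (V' q) = \<tau>" "space_comp A (V' q) = V (snd q)"
    and compW: "time_comp (W' q) = \<sigma>" "space_comp A (W' q) = W (snd q)" for q
    unfolding V'_def W'_def
    using M.time_comp_product_vec[OF VT] M.time_comp_product_vec[OF WT]
      M.space_comp_product_vec[OF VT] M.space_comp_product_vec[OF WT] by auto

  define U where "U = D ?p (V' ?p) V'"
  define B where "B = D ?p (V' ?p) W'"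
  define C where "C = D ?p (W' ?p) V'"
  have UBC: "U \<in> tangent_space (product_atlas A) ?p" "B \<in> tangent_space (product_atlas A) ?p"
      "C \<in> tangent_space (product_atlas A) ?p"
    unfolding U_def B_def C_def by (intro P.levi_civita_tangent[OF LC] V' W' V'T W'T)+
  let ?s = "space_comp A"
  note sT = UBC[THEN M.space_comp_tangent]

  have hessP: "hessian (product_atlas A) D (\<lambda>z. \<phi>\<^sub>0 (snd z)) ?p (product_vec A t x \<tau> v)
      = v (vf_apply V \<phi>\<^sub>0) - ?s U \<phi>\<^sub>0"
  proof -
    have "V' ?p (vf_apply V' (\<lambda>z. \<phi>\<^sub>0 (snd z))) = v (vf_apply V \<phi>\<^sub>0)"
      unfolding vfV[OF \<phi>\<^sub>0] V'snd[OF sm(1)[OF \<phi>\<^sub>0]] by (simp add: V(2))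
    moreover have "?s U \<phi>\<^sub>0 = U (\<lambda>z. \<phi>\<^sub>0 (snd z))"
      using \<phi>\<^sub>0 by (simp add: space_comp_def o_def)
    ultimately show ?thesis
      using P.hessian_eq[OF LC \<phi> V' refl, of ?p] by (simp add: U_def V'p)
  qed
  have hessM: "hessian A DR \<phi>\<^sub>0 x v = v (vf_apply V \<phi>\<^sub>0) - DR x v V \<phi>\<^sub>0"
    by (rule M.hessian_eq[OF LCR \<phi>\<^sub>0 V])

  \<comment> \<open>\<open>W'\<close> represents \<open>d\<phi>\<close> at \<open>(t, x)\<close>; only one representing vector is needed, so nondegeneracy is not.\<close>
  have "?G ?p U (W' ?p) = ?s U \<phi>\<^sub>0 + time_comp U * (\<delta> x \<phi>\<^sub>0 - \<sigma> * (\<beta> x + gR x (\<delta> x) (\<delta> x)))"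
    unfolding stationary_metric_def prod.case compW snd_conv W(2) w_def
    by (simp add: lin(2)[OF n(1) \<delta>T sT(1)] lin(2)[OF n(1) \<delta>T \<delta>T] sym[OF _ n(1)] n(2)[OF sT(1)] n(2)[OF \<delta>T]
        sT(1) \<delta>T sym[OF sT(1) \<delta>T] algebra_simps)
  then have GU: "?G ?p U (W' ?p) = ?s U \<phi>\<^sub>0" using \<sigma> by simp

  \<comment> \<open>By torsion-freeness on the space factor this is the bracket of \<open>V\<close>
    and \<open>W\<close> at \<open>x\<close>, written so that metric compatibility can be applied to
    its two terms.\<close>
  define bR where "bR = lincomb 1 (DR x v W) (- 1) (DR x w V)"
  have DvW: "DR x v W \<in> tangent_space A x" and DwV: "DR x w V \<in> tangent_space A x"
    and DvV: "DR x v V \<in> tangent_space A x"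
    and Dv\<delta>: "DR x v \<delta> \<in> tangent_space A x" and Dw\<delta>: "DR x w \<delta> \<in> tangent_space A x"
    and Dn\<delta>: "DR x n \<delta> \<in> tangent_space A x" and D\<delta>\<delta>: "DR x (\<delta> x) \<delta> \<in> tangent_space A x"
    by (intro M.levi_civita_tangent[OF LCR] V W \<delta> v w n \<delta>T)+
  have bR: "bR \<in> tangent_space A x" unfolding bR_def by (rule M.lincomb_tangent[OF DvW DwV])
  \<comment> \<open>The time component of the bracket is its value on \<open>fst\<close>, and both
    lifts send \<open>fst\<close> to a constant.\<close>
  have timeBC: "time_comp B = time_comp C"
  proof -
    have "vf_apply V' fst = (\<lambda>q. \<tau>)" "vf_apply W' fst = (\<lambda>q. \<sigma>)"
      using compV(1) compW(1) by (simp_all add: vf_apply_def time_comp_def)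
    then have "B fst - C fst = 0"
      using P.levi_civita_torsion[OF LC V' W' M.smooth_fun_fst, of ?p]
        P.tangent_const[OF V'T] P.tangent_const[OF W'T] by (simp add: B_def C_def)
    then show ?thesis by (simp add: time_comp_def)
  qed
  \<comment> \<open>Testing the torsion identity on functions of the space variable shows that the
    space part of the bracket of the lifts is the bracket on the space factor. On functions that are
    not smooth both sides are 0 by convention.\<close>
  have spaceB: "?s B = lincomb 1 (?s C) 1 bR"
  proof
    fix f
    show "?s B f = lincomb 1 (?s C) 1 bR f"
    proof (cases "smooth_fun A f")
      case True
      have "B (\<lambda>z. f (snd z)) - C (\<lambda>z. f (snd z)) = v (vf_apply W f) - w (vf_apply V f)"
        using P.levi_civita_torsion[OF LC V' W' M.smooth_fun_snd[OF True], of ?p]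
        unfolding vfV[OF True] vfW[OF True] V'snd[OF sm(2)[OF True]] W'snd[OF sm(1)[OF True]]
        by (simp add: B_def C_def V(2) W(2))
      also have "\<dots> = DR x v W f - DR x w V f"
        using M.levi_civita_torsion[OF LCR V(1) W(1) True, of x] by (simp add: V(2) W(2))
      finally show ?thesis using True by (simp add: space_comp_def lincomb_def bR_def o_def)
    next
      case False
      then show ?thesis
        using M.tangent_nonsmooth[OF bR] by (simp add: space_comp_def lincomb_def)
    qed
  qed
  have GBC: "?G ?p (V' ?p) B = ?G ?p (V' ?p) C + gR x v bR + \<tau> * gR x (\<delta> x) bR"
    unfolding stationary_metric_def prod.case compV snd_conv V(2) spaceB timeBC
    by (simp add: lin(2)[OF sT(3) bR v] lin(2)[OF sT(3) bR \<delta>T] algebra_simps)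
  have Gsym: "?G ?p C (V' ?p) = ?G ?p (V' ?p) C"
    unfolding stationary_metric_def prod.case compV snd_conv V(2)
    by (simp add: sym[OF v sT(3)])

  have smVW: "smooth_fun A (\<lambda>q. gR q (V q) (W q))" "smooth_fun A (\<lambda>q. gR q (V q) (V q))"
    and sm\<delta>: "smooth_fun A (\<lambda>q. gR q (\<delta> q) (W q))" "smooth_fun A (\<lambda>q. gR q (\<delta> q) (V q))"
    by (intro M.riemannian_metric_smooth[OF gR] V W \<delta>)+
  have GVW: "V' ?p (\<lambda>q. ?G q (V' q) (W' q)) = - \<tau> * \<sigma> * v \<beta> + v (\<lambda>q. gR q (V q) (W q))
      + \<tau> * v (\<lambda>q. gR q (\<delta> q) (W q)) + \<sigma> * v (\<lambda>q. gR q (\<delta> q) (V q))"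
  proof -
    let ?h = "\<lambda>y. ((- \<tau> * \<sigma>) * \<beta> y + gR y (V y) (W y)) + (\<tau> * gR y (\<delta> y) (W y) + \<sigma> * gR y (\<delta> y) (V y))"
    have "(\<lambda>q. ?G q (V' q) (W' q)) = (\<lambda>q. ?h (snd q))"
      by (simp add: fun_eq_iff stationary_metric_def compV compW case_prod_beta algebra_simps)
    moreover have s1: "smooth_fun A (\<lambda>y. (- \<tau> * \<sigma>) * \<beta> y + gR y (V y) (W y))"
      and s2: "smooth_fun A (\<lambda>y. \<tau> * gR y (\<delta> y) (W y) + \<sigma> * gR y (\<delta> y) (V y))"
      by (intro M.smooth_fun_add M.smooth_fun_mult M.smooth_fun_const \<beta> smVW sm\<delta>)+
    moreover have "v ?h = ((- \<tau> * \<sigma>) * v \<beta> + v (\<lambda>q. gR q (V q) (W q)))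
        + (\<tau> * v (\<lambda>q. gR q (\<delta> q) (W q)) + \<sigma> * v (\<lambda>q. gR q (\<delta> q) (V q)))"
      using M.tangent_add[OF v s1 s2] M.tangent_lincomb[OF v \<beta> smVW(1), of "- \<tau> * \<sigma>" 1]
        M.tangent_lincomb[OF v sm\<delta>, of \<tau> \<sigma>] by simp
    ultimately show ?thesis using V'snd[OF M.smooth_fun_add[OF s1 s2], of ?p] by (simp add: V(2))
  qed
  have GVV: "W' ?p (\<lambda>q. ?G q (V' q) (V' q)) = - \<tau>\<^sup>2 * w \<beta> + w (\<lambda>q. gR q (V q) (V q))
      + 2 * \<tau> * w (\<lambda>q. gR q (\<delta> q) (V q))"
  proof -
    let ?h = "\<lambda>y. ((- \<tau>\<^sup>2) * \<beta> y + gR y (V y) (V y)) + (2 * \<tau>) * gR y (\<delta> y) (V y)"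
    have "(\<lambda>q. ?G q (V' q) (V' q)) = (\<lambda>q. ?h (snd q))"
      by (simp add: fun_eq_iff stationary_metric_def compV case_prod_beta power2_eq_square algebra_simps)
    moreover have s1: "smooth_fun A (\<lambda>y. (- \<tau>\<^sup>2) * \<beta> y + gR y (V y) (V y))"
      and s2: "smooth_fun A (\<lambda>y. (2 * \<tau>) * gR y (\<delta> y) (V y))"
      by (intro M.smooth_fun_add M.smooth_fun_mult M.smooth_fun_const \<beta> smVW sm\<delta>)+
    moreover have "w ?h = ((- \<tau>\<^sup>2) * w \<beta> + w (\<lambda>q. gR q (V q) (V q))) + (2 * \<tau>) * w (\<lambda>q. gR q (\<delta> q) (V q))"
      using M.tangent_add[OF w s1 s2] M.tangent_lincomb[OF w \<beta> smVW(2), of "- \<tau>\<^sup>2" 1]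
        M.tangent_scale[OF w sm\<delta>(2), of "2 * \<tau>"] by simp
    ultimately show ?thesis using W'snd[OF M.smooth_fun_add[OF s1 s2], of ?p] by (simp add: W(2))
  qed

  have compatVW: "V' ?p (\<lambda>q. ?G q (V' q) (W' q)) = ?s U \<phi>\<^sub>0 + ?G ?p (V' ?p) B"
    using P.levi_civita_metric[OF LC V' W' V'T] GU by (simp add: U_def B_def)
  have compatVV: "W' ?p (\<lambda>q. ?G q (V' q) (V' q)) = 2 * ?G ?p (V' ?p) C"
    using P.levi_civita_metric[OF LC V' V' W'T, of ?p] Gsym by (simp add: C_def)
  note compatR = M.levi_civita_metric[OF LCR]
  have R: "v (\<lambda>q. gR q (V q) (W q)) = gR x (DR x v V) w + gR x v (DR x v W)"
    "w (\<lambda>q. gR q (V q) (V q)) = 2 * gR x v (DR x w V)"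
    "v (\<lambda>q. gR q (\<delta> q) (W q)) = gR x (DR x v \<delta>) w + gR x (\<delta> x) (DR x v W)"
    "v (\<lambda>q. gR q (\<delta> q) (V q)) = gR x (DR x v \<delta>) v + gR x (\<delta> x) (DR x v V)"
    "w (\<lambda>q. gR q (\<delta> q) (V q)) = gR x (DR x w \<delta>) v + gR x (\<delta> x) (DR x w V)"
    using compatR[OF V(1) W(1) v] compatR[OF V(1) V(1) w] compatR[OF \<delta> W(1) v] compatR[OF \<delta> V(1) v]
      compatR[OF \<delta> V(1) w] sym[OF DwV v] by (simp_all add: V(2) W(2))
  have b: "gR x v bR = gR x v (DR x v W) - gR x v (DR x w V)"
    "gR x (\<delta> x) bR = gR x (\<delta> x) (DR x v W) - gR x (\<delta> x) (DR x w V)"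
    unfolding bR_def by (simp_all add: lin(2)[OF DvW DwV v] lin(2)[OF DvW DwV \<delta>T])
  \<comment> \<open>Half of the derivative of the squared length replaces the product with
    \<open>C\<close>. The terms in \<open>DR x v W\<close> and \<open>DR x w V\<close> cancel
    between the derivatives of the metric and the bracket, leaving derivatives of \<beta>, of
    \<delta> and of \<open>V\<close> along \<open>v\<close>.\<close>
  have koszul: "?s U \<phi>\<^sub>0 = - \<tau> * \<sigma> * v \<beta> + 1 / 2 * \<tau>\<^sup>2 * w \<beta> + gR x (DR x v V) w
      + \<sigma> * (gR x (DR x v \<delta>) v + gR x (\<delta> x) (DR x v V))
      + \<tau> * (gR x (DR x v \<delta>) w - gR x (DR x w \<delta>) v)"
    using compatVW compatVV GBC unfolding GVW GVV R b by (simp add: algebra_simps)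

  have wexp: "w \<beta> = gradient A gR \<beta> x \<phi>\<^sub>0 - \<sigma> * \<delta> x \<beta>"
  proof -
    \<comment> \<open>Both sides are the inner product of the two gradients, by symmetry of the
      metric.\<close>
    have "n \<beta> = gradient A gR \<beta> x \<phi>\<^sub>0"
      using M.gradient[OF gR \<beta>] n sym by metis
    then show ?thesis by (simp add: w_def lincomb_def)
  qed
  \<comment> \<open>The correction by \<sigma> cancels the term
    \<open>\<sigma> * gR x (\<delta> x) (DR x v V)\<close> of \<open>koszul\<close>, so that the
    derivative of \<phi> needed for the spatial Hessian remains.\<close>
  have g1: "gR x (DR x v V) w = DR x v V \<phi>\<^sub>0 - \<sigma> * gR x (\<delta> x) (DR x v V)"
    unfolding w_def using n(2)[OF DvV]
    by (simp add: lin(2)[OF n(1) \<delta>T DvV] sym[OF DvV n(1)] sym[OF DvV \<delta>T])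
  have g2: "gR x (DR x v \<delta>) w = gR x (DR x v \<delta>) n - \<sigma> * gR x (DR x v \<delta>) (\<delta> x)"
    unfolding w_def by (simp add: lin(2)[OF n(1) \<delta>T Dv\<delta>])
  have g3: "gR x (DR x w \<delta>) v = gR x (DR x n \<delta>) v - \<sigma> * gR x (DR x (\<delta> x) \<delta>) v"
    unfolding w_def M.levi_civita_lincomb[OF LCR \<delta> n(1) \<delta>T] by (simp add: lin(1)[OF Dn\<delta> D\<delta>\<delta> v])
  show ?thesis
    unfolding hessP hessM koszul wexp g1 g2 g3 sym_cov_def rot_def cov_def n_def[symmetric]
    by (simp add: algebra_simps power2_eq_square)
qed

theorem theorem3:
  fixes A :: "('m::{t2_space, second_countable_topology}, 'e::euclidean_space) chart set"
    and gR :: "'m metric_field" and \<beta> :: "'m \<Rightarrow> real" and \<delta> :: "'m vfield"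
    and D :: "(real \<times> 'm) connection" and DR :: "'m connection"
    and \<phi> :: "real \<times> 'm \<Rightarrow> real" and \<phi>\<^sub>0 :: "'m \<Rightarrow> real"
    and t :: real and x :: 'm and \<tau> :: real and v :: "'m tvec" and \<Lambda> :: real
  assumes "smooth_atlas A"
    and "riemannian_metric A gR"
    and "smooth_fun A \<beta>" and "\<And>y. 0 < \<beta> y"
    and "smooth_vfield A \<delta>"
    and "levi_civita A gR DR"
    and "levi_civita (product_atlas A) (stationary_metric A gR \<beta> \<delta>) D"
    and "smooth_fun (product_atlas A) \<phi>" and "\<And>s y. \<phi> (s, y) = \<phi>\<^sub>0 y"
    and "v \<in> tangent_space A x"
    and "\<Lambda> = - 1 / (\<beta> x + gR x (\<delta> x) (\<delta> x))"
  shows "hessian (product_atlas A) D \<phi> (t, x) (product_vec A t x \<tau> v) =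
    hessian A DR \<phi>\<^sub>0 x v
    - \<Lambda> * (\<tau> * v \<beta> + 1 / 2 * \<tau>\<^sup>2 * \<delta> x \<beta> - sym_cov gR DR \<delta> x v v
            + \<tau> * rot gR DR \<delta> x v (\<delta> x)) * \<delta> x \<phi>\<^sub>0
    + \<tau> * rot gR DR \<delta> x (gradient A gR \<phi>\<^sub>0 x) v
    - 1 / 2 * \<tau>\<^sup>2 * gradient A gR \<beta> x \<phi>\<^sub>0"
proof -
  have \<phi>: "\<phi> = (\<lambda>z. \<phi>\<^sub>0 (snd z))" using assms(9) by (simp add: fun_eq_iff split_paired_all)
  have \<delta>T: "\<delta> x \<in> tangent_space A x" using assms(5) by (simp add: smooth_vfield_def)
  \<comment> \<open>With \<beta> positive this makes the denominator of \<Lambda> nonzero.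
    Positivity of the metric speaks of nonzero vectors, so the zero vector is treated separately, as
    a linear combination with zero coefficients.\<close>
  have "0 \<le> gR x (\<delta> x) (\<delta> x)"
  proof (cases "\<delta> x = (\<lambda>f. 0)")
    case True
    have "gR x (lincomb 0 (\<delta> x) 0 (\<delta> x)) (\<delta> x) = 0"
      using assms(2) \<delta>T unfolding riemannian_metric_def by simp
    then show ?thesis using True by (simp add: lincomb_def)
  next
    case False
    then show ?thesis using assms(2) \<delta>T unfolding riemannian_metric_def by (metis less_imp_le)
  qed
  then have \<sigma>: "(- \<Lambda> * \<delta> x \<phi>\<^sub>0) * (\<beta> x + gR x (\<delta> x) (\<delta> x)) = \<delta> x \<phi>\<^sub>0"
    using assms(4)[of x] by (simp add: assms(11))
  have "smooth_fun (product_atlas A) (\<lambda>z. \<phi>\<^sub>0 (snd z))" using assms(8) \<phi> by simp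
  note hessian_stationary[where A = A and gR = gR and \<beta> = \<beta> and \<delta> = \<delta> and DR = DR and D = D and \<phi>\<^sub>0 = \<phi>\<^sub>0
      and x = x and v = v and \<sigma> = "- \<Lambda> * \<delta> x \<phi>\<^sub>0" and t = t and \<tau> = \<tau>,
      OF assms(1-3) assms(5-7) this assms(10) \<sigma>]
  then show ?thesis unfolding \<phi> by (simp add: mult_ac)
qed

end
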